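(* Let $(X^r(t),t\ge 0)$, $r=1,2,\ldots$, be a sequence of Markov processes satisfying properties (1)–(4) of the model in the context, and let $\hat Z_i^r(\infty)$, $\hat Z^r(\infty)=\sum_{i\in I}\hat Z^r_i(\infty)$ be the associated diffusion-scaled steady-state variables. The following properties hold. (i) If $\nu_i\le\mu_i$ for all $i\in I$ (including possibly $\nu_i=0$ for some $i$), then for every $\theta>0$ $$\limsup_{r\to\infty}\mathbb{E}\exp\Big(\theta\sum_{i\in I}\hat Z_i^{r,-}(\infty)\Big)<\infty.$$ (ii) There exists $\bar\theta>0$ such that for every $\theta\in[0,\bar\theta]$ $$\limsup_{r\to\infty}\mathbb{E}\exp\Big(\theta\sum_{i\in I}\hat Z_i^{r,+}(\infty)\Big)<\infty.$$ (iii) There exists $\bar\theta'>0$ such that for every $\theta\in[0,\bar\theta']$ $$\limsup_{r\to\infty}\mathbb{E}\exp\Big(\theta\sum_{i\in I}\hat Z_i^{r,-}(\infty)\Big)<\infty.$$ (iv) In particular, the sequence of random variables $\hat Z^r(\infty)$, $r=1,2,\ldots$, is tight.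
   Context: Model. Fix a finite nonempty set $I$ of customer classes, a real $a>0$, and for each $i\in I$ numbers $\lambda_i>0$, $\mu_i>0$, $\nu_i\ge 0$ (arrival, service and abandonment rate parameters), with $\rho_i=\lambda_i/\mu_i$ and $\sum_{i\in I}\rho_i=1$. These are independent of $r$. For $r=1,2,\ldots$ let $N^r=\lceil r+a\sqrt r\rceil$ (number of servers). For each $r$, $(X^r(t),t\ge 0)$ is a continuous-time Markov process (given by its transition rates) on a countable state space $\mathcal{X}^r$ such that: (1) There is a deterministic function $f$ with $f(X^r(t))=\big((Z_i^r(t))_{i\in I},(\Psi_i^r(t))_{i\in I}\big)\in\mathbb{Z}_+^{2|I|}$, where $\Psi_i^r(t)\le Z_i^r(t)$ for all $i$, and every value in the range of $f$ has a finite pre-image. Put $Q_i^r(t)=Z_i^r(t)-\Psi_i^r(t)$. ($Z_i^r$, $\Psi_i^r$, $Q_i^r$ are the numbers of class-$i$ customers in the system, in service, and in queue.) (2) (Non-idling) $\sum_{i}\Psi_i^r(t)=\min\{N^r,\sum_{i}Z_i^r(t)\}$. (3) In any state: (a) for each $\ell\in I$, the total rate of all transitions changing $(Z_i^r)_{i\in I}$ to $(Z_i^r)_{i\in I}+e_\ell$ ($e_\ell$ the $\ell$-th unit vector) is $\lambda_\ell r$; (b) if $Z_\ell^r\ge 1$, the total rate of all transitions changing $(Z_i^r)_{i\in I}$ to $(Z_i^r)_{i\in I}-e_\ell$ is $\mu_\ell\Psi_\ell^r+\nu_\ell Q_\ell^r$; (c) transitions changing some $Z_i^r$ by more than 1,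 or changing more than one component of $(Z_i^r)_{i\in I}$, have zero rate. (Transitions leaving $(Z_i^r)$ unchanged are allowed.) (4) $X^r$ is irreducible. The processes for different $r$ need not be related (the scheduling policy may depend on $r$). Under (1)–(4) the process $X^r$ is non-explosive and positive recurrent with a unique stationary distribution $\pi^r$; the argument $(\infty)$ denotes the value of a variable when $X^r$ is distributed according to $\pi^r$. Diffusion scaling: $\hat Z_i^r=(Z_i^r-\rho_i r)/\sqrt r$, $\hat Z^r=\sum_i\hat Z_i^r$. For real $b$, $b^+=\max(b,0)$, $b^-=-\min(b,0)$; $\hat Z_i^{r,\pm}=(\hat Z_i^r)^\pm$. *)

theory Defs
  imports "HOL-Probability.Probability"
begin

text \<open>
  A continuous-time Markov process on a countable set \<open>S\<close> is given by its transition
  rates \<open>q x y\<close> (from \<open>x\<close> to \<open>y\<close>, with \<open>x \<noteq> y\<close>). The diagonal values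
  \<open>q x x\<close> carry no meaning and are never used below.
\<close>

definition transition_rates :: "'s set \<Rightarrow> ('s \<Rightarrow> 's \<Rightarrow> real) \<Rightarrow> bool" where
  "transition_rates S q \<longleftrightarrow> countable S \<and>
     (\<forall>x\<in>S. (\<forall>y\<in>S - {x}. q x y \<ge> 0) \<and> q x summable_on (S - {x}))"

definition exit_rate :: "'s set \<Rightarrow> ('s \<Rightarrow> 's \<Rightarrow> real) \<Rightarrow> 's \<Rightarrow> real" where
  "exit_rate S q x = (\<Sum>\<^sub>\<infinity>y\<in>S - {x}. q x y)"

text \<open>
  \<open>jump_prob S q n t x y\<close> is the probability that the process started in \<open>x\<close> makes at
  most \<open>n\<close> jumps during \<open>[0, t]\<close> and is in \<open>y\<close> at time \<open>t\<close>: it stays in \<open>x\<close> for an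
  exponential time with parameter \<open>exit_rate S q x\<close> and then jumps to \<open>z\<close> with
  probability \<open>q x z / exit_rate S q x\<close> (recursion on the first jump).
  Letting \<open>n\<close> tend to infinity gives the (minimal) transition function with rates \<open>q\<close>.
\<close>

primrec jump_prob ::
  "'s set \<Rightarrow> ('s \<Rightarrow> 's \<Rightarrow> real) \<Rightarrow> nat \<Rightarrow> real \<Rightarrow> 's \<Rightarrow> 's \<Rightarrow> ennreal" where
  "jump_prob S q 0 = (\<lambda>t x y. if x = y then ennreal (exp (- exit_rate S q x * t)) else 0)"
| "jump_prob S q (Suc n) = (\<lambda>t x y.
     (if x = y then ennreal (exp (- exit_rate S q x * t)) else 0) +
     (\<integral>\<^sup>+s\<in>{0..t}. ennreal (exp (- exit_rate S q x * s)) *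
        (\<integral>\<^sup>+z. ennreal (q x z) * jump_prob S q n (t - s) z y \<partial>count_space (S - {x})) \<partial>lborel))"

definition transition_prob ::
  "'s set \<Rightarrow> ('s \<Rightarrow> 's \<Rightarrow> real) \<Rightarrow> real \<Rightarrow> 's \<Rightarrow> 's \<Rightarrow> ennreal" where
  "transition_prob S q t x y = (SUP n. jump_prob S q n t x y)"

definition stationary_distribution ::
  "'s set \<Rightarrow> ('s \<Rightarrow> 's \<Rightarrow> real) \<Rightarrow> 's pmf \<Rightarrow> bool" where
  "stationary_distribution S q p \<longleftrightarrow> set_pmf p \<subseteq> S \<and>
     (\<forall>t\<ge>0. \<forall>y\<in>S. (\<integral>\<^sup>+x. transition_prob S q t x y \<partial>measure_pmf p) = ennreal (pmf p y))"

definition irreducible_rates :: "'s set \<Rightarrow> ('s \<Rightarrow> 's \<Rightarrow> real) \<Rightarrow> bool" where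
  "irreducible_rates S q \<longleftrightarrow>
     (\<forall>x\<in>S. \<forall>y\<in>S. (x, y) \<in> {(u, v). u \<in> S \<and> v \<in> S \<and> u \<noteq> v \<and> q u v > 0}\<^sup>*)"

definition num_servers :: "real \<Rightarrow> nat \<Rightarrow> nat" where
  "num_servers a r = nat \<lceil>real r + a * sqrt (real r)\<rceil>"

text \<open>
  In state \<open>x\<close>, \<open>f x = (Z, \<Psi>)\<close> where \<open>Z i\<close> and \<open>\<Psi> i\<close> are the numbers of class-\<open>i\<close>
  customers in the system and in service; \<open>Z i - \<Psi> i\<close> of them are in queue.
\<close>

definition service_system ::
  "real \<Rightarrow> ('i::finite \<Rightarrow> real) \<Rightarrow> ('i \<Rightarrow> real) \<Rightarrow> ('i \<Rightarrow> real) \<Rightarrow> nat \<Rightarrow>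
   's set \<Rightarrow> ('s \<Rightarrow> 's \<Rightarrow> real) \<Rightarrow> ('s \<Rightarrow> ('i \<Rightarrow> nat) \<times> ('i \<Rightarrow> nat)) \<Rightarrow> bool" where
  "service_system a lam mu nu r S q f \<longleftrightarrow>
     (let Z = (\<lambda>x. fst (f x)); \<Psi> = (\<lambda>x. snd (f x)) in
      transition_rates S q \<and>
      (\<forall>x\<in>S. \<forall>i. \<Psi> x i \<le> Z x i) \<and>
      (\<forall>x\<in>S. finite {y \<in> S. f y = f x}) \<and>
      (\<forall>x\<in>S. (\<Sum>i\<in>UNIV. \<Psi> x i) = min (num_servers a r) (\<Sum>i\<in>UNIV. Z x i)) \<and>
      (\<forall>x\<in>S. \<forall>l. (q x has_sum lam l * real r)
         {y \<in> S. Z y = (Z x)(l := Z x l + 1)}) \<and>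
      (\<forall>x\<in>S. \<forall>l. Z x l \<ge> 1 \<longrightarrow>
         (q x has_sum mu l * real (\<Psi> x l) + nu l * (real (Z x l) - real (\<Psi> x l)))
         {y \<in> S. Z y = (Z x)(l := Z x l - 1)}) \<and>
      (\<forall>x\<in>S. \<forall>y\<in>S. (\<exists>i. \<bar>int (Z y i) - int (Z x i)\<bar> > 1) \<or> card {i. Z y i \<noteq> Z x i} > 1
         \<longrightarrow> q x y = 0) \<and>
      irreducible_rates S q)"

definition Zhat ::
  "('i \<Rightarrow> real) \<Rightarrow> ('i \<Rightarrow> real) \<Rightarrow> nat \<Rightarrow> ('s \<Rightarrow> ('i \<Rightarrow> nat) \<times> ('i \<Rightarrow> nat)) \<Rightarrow> 's \<Rightarrow> 'i \<Rightarrow> real" where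
  "Zhat lam mu r f x i = (real (fst (f x) i) - lam i / mu i * real r) / sqrt (real r)"

definition pos_part :: "real \<Rightarrow> real" where
  "pos_part b = max b 0"

definition neg_part :: "real \<Rightarrow> real" where
  "neg_part b = - min b 0"

end

theory Submission
  imports Defs
begin

text \<open>
  If the generator satisfies \<open>Q V \<le> - c V + c K\<close> for some \<open>V \<ge> 0\<close>, then
  \<open>P\<^sub>t V \<le> exp (- c t) (V - K) + K\<close> (induction on the number of jumps), and letting \<open>t\<close> tend to
  infinity under a stationary distribution gives \<open>E V \<le> K\<close>, whatever the policy. Write \<open>z i\<close> for
  the scaled class counts, \<open>\<psi> i\<close> for the scaled numbers in service and \<open>\<kappa> i = z i - \<psi> i \<ge> 0\<close> for
  the scaled queues, so that \<open>z i\<close> has drift \<open>- (mu i \<psi> i + nu i \<kappa> i)\<close>.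

  For (i), \<open>nu i \<le> mu i\<close> makes this drift at least \<open>- mu i z i\<close>, and \<open>V = exp (- \<theta> z i)\<close> works for
  each class and every \<open>\<theta>\<close>. For (ii)-(iv), take \<open>V = exp (\<theta> \<Sum>i. w (z i) / mu i)\<close> with \<open>w\<close> convex and
  smooth, \<open>w' = 1\<close> on \<open>z \<ge> 0\<close> and \<open>w' = - e\<close> far to the left. If all servers are busy,
  \<open>\<Sum>i. \<psi> i \<ge> a\<close>, and replacing \<open>w'\<close> by 1 only loses terms with \<open>z i < 0\<close>, where \<open>\<psi> i \<le> z i < 0\<close> has
  the favourable sign: the exponent has drift at most \<open>- a\<close>. Otherwise there is no queue, \<open>\<psi> = z\<close>, and the
  drift is at most a constant minus \<open>e \<Sum>i. \<bar>z i\<bar>\<close>. All bounds are uniform in \<open>r \<ge> 1\<close>.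
\<close>

section \<open>Drift criterion for stationary distributions\<close>

lemma nn_integral_count_space_has_sum:
  fixes h :: "'a \<Rightarrow> real"
  assumes "(h has_sum s) A" "\<And>x. x \<in> A \<Longrightarrow> h x \<ge> 0"
  shows "(\<integral>\<^sup>+x. ennreal (h x) \<partial>count_space A) = ennreal s"
proof -
  have "(\<lambda>x. norm (h x)) summable_on A"
    using assms summable_on_cong[of A "\<lambda>x. norm (h x)" h] by (auto simp: summable_on_def)
  then have abs: "Infinite_Set_Sum.abs_summable_on h A"
    unfolding abs_summable_equivalent[symmetric] by simp
  have "(\<integral>\<^sup>+x. ennreal (h x) \<partial>count_space A) = ennreal (infsetsum h A)"
    by (rule nn_integral_conv_infsetsum[OF abs]) (use assms in auto)
  also have "infsetsum h A = s"
    using infsetsum_infsum[OF abs] infsumI[OF assms(1)] by simp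
  finally show ?thesis .
qed

lemma nn_integral_exit_rate:
  assumes "transition_rates S q" "x \<in> S"
  shows "(\<integral>\<^sup>+y. ennreal (q x y) \<partial>count_space (S - {x})) = ennreal (exit_rate S q x)"
proof -
  have "(q x has_sum exit_rate S q x) (S - {x})"
    using assms unfolding transition_rates_def exit_rate_def by auto
  then show ?thesis
    using assms by (intro nn_integral_count_space_has_sum) (auto simp: transition_rates_def)
qed

lemma exit_rate_nonneg:
  assumes "transition_rates S q" "x \<in> S"
  shows "exit_rate S q x \<ge> 0"
  unfolding exit_rate_def using assms by (intro infsum_nonneg) (auto simp: transition_rates_def)

section \<open>Jump-limited transition functions and the first-jump recursion\<close>

text \<open>Supplies the measurability behind the Tonelli arguments below. The time integrand
  depends on both \<open>t\<close> and \<open>s\<close>, so joint measurability is needed; since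
  \<open>S\<close> is countable, adding the discrete variable \<open>z\<close> requires only
  measurability for each fixed \<open>z\<close>.\<close>

lemma jump_prob_measurable:
  assumes "countable S"
  shows "(\<lambda>t. jump_prob S q n t x y) \<in> borel_measurable borel"
proof (induction n arbitrary: x y)
  case 0
  then show ?case by simp
next
  case (Suc n)
  have [measurable]: "(\<lambda>t. jump_prob S q n t x y) \<in> borel_measurable borel" for x y
    by (rule Suc.IH)
  have cS: "countable (S - {x})" using assms by auto
  then interpret C: sigma_finite_measure "count_space (S - {x})"
    by (rule sigma_finite_measure_count_space_countable)
  have m1: "(\<lambda>(w, z). ennreal (q x z) * jump_prob S q n (fst w - snd w) z y)
      \<in> borel_measurable ((borel \<Otimes>\<^sub>M (lborel :: real measure)) \<Otimes>\<^sub>M count_space (S - {x}))"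
    unfolding split_beta
    by (rule measurable_compose_countable'[where g=snd and I="S - {x}"
          and f="\<lambda>z w. ennreal (q x z) * jump_prob S q n (fst (fst w) - snd (fst w)) z y"])
       (use cS in simp_all)
  then have int: "(\<lambda>w. \<integral>\<^sup>+z. ennreal (q x z) * jump_prob S q n (fst w - snd w) z y \<partial>count_space (S - {x}))
      \<in> borel_measurable (borel \<Otimes>\<^sub>M (lborel :: real measure))"
    by (rule C.borel_measurable_nn_integral)
  have [measurable]: "(\<lambda>w. indicator {0..fst w} (snd w) :: ennreal) \<in> borel_measurable (borel \<Otimes>\<^sub>M (lborel :: real measure))"
  proof -
    have "(\<lambda>w::real \<times> real. indicator {0..fst w} (snd w) :: ennreal) =
        indicator {w. 0 \<le> snd w \<and> snd w \<le> fst w}"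
      by (auto split: split_indicator)
    then show ?thesis by simp
  qed
  have "(\<lambda>w. ennreal (exp (- exit_rate S q x * snd w)) *
      (\<integral>\<^sup>+z. ennreal (q x z) * jump_prob S q n (fst w - snd w) z y \<partial>count_space (S - {x}))
      * indicator {0..fst w} (snd w))
      \<in> borel_measurable (borel \<Otimes>\<^sub>M (lborel :: real measure))"
    by (intro borel_measurable_times_ennreal int) measurable
  then have "(\<lambda>t. \<integral>\<^sup>+s. ennreal (exp (- exit_rate S q x * s)) *
      (\<integral>\<^sup>+z. ennreal (q x z) * jump_prob S q n (t - s) z y \<partial>count_space (S - {x}))
      * indicator {0..t} s \<partial>lborel) \<in> borel_measurable borel"
    by (intro lborel.borel_measurable_nn_integral) (simp add: split_beta)
  then show ?case by simp
qed

lemma jump_prob_mono: "jump_prob S q n t x y \<le> jump_prob S q (Suc n) t x y"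
proof (induction n arbitrary: t x y)
  case 0
  then show ?case by simp
next
  case (Suc n)
  have "jump_prob S q (Suc n) t x y \<le> (if x = y then ennreal (exp (- exit_rate S q x * t)) else 0) +
     (\<integral>\<^sup>+s\<in>{0..t}. ennreal (exp (- exit_rate S q x * s)) *
        (\<integral>\<^sup>+z. ennreal (q x z) * jump_prob S q (Suc n) (t - s) z y \<partial>count_space (S - {x})) \<partial>lborel)"
    by (subst jump_prob.simps(2)[of S q n])
       (intro add_left_mono nn_integral_mono mult_right_mono mult_left_mono Suc.IH; simp)
  then show ?case by (simp only: jump_prob.simps)
qed

lemma nn_integral_count_space_delta:
  assumes "x \<in> S"
  shows "(\<integral>\<^sup>+y. (if x = y then a else 0) * g y \<partial>count_space S) = a * (g x :: ennreal)"
proof -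
  have "(\<integral>\<^sup>+y. (if x = y then a else 0) * g y \<partial>count_space S) =
      (\<integral>\<^sup>+y. (a * g x) * indicator {x} y \<partial>count_space S)"
    by (intro nn_integral_cong) auto
  also have "\<dots> = a * g x"
    using assms by (subst nn_integral_cmult_indicator) auto
  finally show ?thesis .
qed

text \<open>Tonelli moves the sum over \<open>y\<close> inside the time integral and the sum over
  \<open>z\<close>. The recursion for transition probabilities becomes one for expectations of
  \<open>g\<close>, on which the drift bound can be proved by induction.\<close>

lemma nn_integral_jump_prob_Suc:
  assumes "countable S" "x \<in> S"
  shows "(\<integral>\<^sup>+y. jump_prob S q (Suc n) t x y * g y \<partial>count_space S) =
    ennreal (exp (- exit_rate S q x * t)) * g x +
    (\<integral>\<^sup>+s\<in>{0..t}. ennreal (exp (- exit_rate S q x * s)) *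
       (\<integral>\<^sup>+z. ennreal (q x z) * (\<integral>\<^sup>+y. jump_prob S q n (t - s) z y * g y \<partial>count_space S)
          \<partial>count_space (S - {x})) \<partial>lborel)"
proof -
  have cS: "countable (S - {x})" using assms by auto
  have [measurable]: "(\<lambda>t. jump_prob S q n t x y) \<in> borel_measurable borel" for x y
    by (rule jump_prob_measurable[OF assms(1)])
  interpret C: sigma_finite_measure "count_space (S - {x})"
    using cS by (rule sigma_finite_measure_count_space_countable)
  define H where "H y s = (\<integral>\<^sup>+z. ennreal (q x z) * jump_prob S q n (t - s) z y \<partial>count_space (S - {x}))" for y s
  have "(\<lambda>w. ennreal (q x (snd w)) * jump_prob S q n (t - fst w) (snd w) y)
      \<in> borel_measurable ((lborel :: real measure) \<Otimes>\<^sub>M count_space (S - {x}))" for y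
    by (rule measurable_compose_countable'[where g=snd and I="S - {x}"
          and f="\<lambda>z w. ennreal (q x z) * jump_prob S q n (t - fst w) z y"])
       (use cS in simp_all)
  then have [measurable]: "H y \<in> borel_measurable lborel" for y
    unfolding H_def by (intro C.borel_measurable_nn_integral) (simp add: split_beta)
  have inner: "(\<integral>\<^sup>+y. H y s * g y \<partial>count_space S) =
      (\<integral>\<^sup>+z. ennreal (q x z) * (\<integral>\<^sup>+y. jump_prob S q n (t - s) z y * g y \<partial>count_space S)
          \<partial>count_space (S - {x}))" for s
  proof -
    have "(\<integral>\<^sup>+y. H y s * g y \<partial>count_space S) =
      (\<integral>\<^sup>+y. \<integral>\<^sup>+z. ennreal (q x z) * (jump_prob S q n (t - s) z y * g y) \<partial>count_space (S - {x}) \<partial>count_space S)"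
      unfolding H_def by (subst nn_integral_multc[symmetric]) (simp_all add: mult.assoc)
    also have "\<dots> = (\<integral>\<^sup>+z. \<integral>\<^sup>+y. ennreal (q x z) * (jump_prob S q n (t - s) z y * g y) \<partial>count_space S \<partial>count_space (S - {x}))"
      using cS by (intro nn_integral_count_space_nn_integral) auto
    finally show ?thesis by (simp add: nn_integral_cmult)
  qed
  have "(\<integral>\<^sup>+y. jump_prob S q (Suc n) t x y * g y \<partial>count_space S) =
    (\<integral>\<^sup>+y. (if x = y then ennreal (exp (- exit_rate S q x * t)) else 0) * g y
      + (\<integral>\<^sup>+s. ennreal (exp (- exit_rate S q x * s)) * H y s * indicator {0..t} s * g y \<partial>lborel) \<partial>count_space S)"
    unfolding H_def[symmetric] jump_prob.simps(2) distrib_right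
    by (subst nn_integral_multc) (simp_all add: H_def[symmetric])
  also have "\<dots> = ennreal (exp (- exit_rate S q x * t)) * g x +
     (\<integral>\<^sup>+y. (\<integral>\<^sup>+s. ennreal (exp (- exit_rate S q x * s)) * H y s * indicator {0..t} s * g y \<partial>lborel) \<partial>count_space S)"
    by (subst nn_integral_add) (simp_all add: nn_integral_count_space_delta[OF assms(2)])
  also have "(\<integral>\<^sup>+y. (\<integral>\<^sup>+s. ennreal (exp (- exit_rate S q x * s)) * H y s * indicator {0..t} s * g y \<partial>lborel) \<partial>count_space S)
     = (\<integral>\<^sup>+s. (\<integral>\<^sup>+y. (ennreal (exp (- exit_rate S q x * s)) * indicator {0..t} s) * (H y s * g y) \<partial>count_space S) \<partial>lborel)"
    using assms(1) by (subst nn_integral_count_space_nn_integral[symmetric]) (auto simp: mult_ac)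
  also have "\<dots> = (\<integral>\<^sup>+s\<in>{0..t}. ennreal (exp (- exit_rate S q x * s)) *
       (\<integral>\<^sup>+z. ennreal (q x z) * (\<integral>\<^sup>+y. jump_prob S q n (t - s) z y * g y \<partial>count_space S)
          \<partial>count_space (S - {x})) \<partial>lborel)"
    by (subst nn_integral_cmult, simp, simp only: inner, simp only: mult_ac)
  finally show ?thesis .
qed

section \<open>Lyapunov bounds for transition functions and stationary distributions\<close>

text \<open>The right-hand side is a supersolution of the first-jump recursion, so it dominates
  every iterate. The drift condition is written with all terms added, because subtraction is
  unsuitable in \<open>ennreal\<close> and integrability of \<open>V\<close> under the jump rates is
  part of what the condition asserts.\<close>

lemma jump_prob_drift_bound:
  fixes V :: "'s \<Rightarrow> real"
  assumes R: "transition_rates S q"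
    and V: "\<And>x. x \<in> S \<Longrightarrow> V x \<ge> 0"
    and cK: "c > 0" "K \<ge> 0"
    and drift: "\<And>x. x \<in> S \<Longrightarrow>
      (\<integral>\<^sup>+z. ennreal (q x z) * ennreal (V z) \<partial>count_space (S - {x})) + ennreal (c * V x)
        \<le> ennreal (exit_rate S q x * V x + c * K)"
    and "x \<in> S" "t \<ge> 0"
  shows "(\<integral>\<^sup>+y. jump_prob S q n t x y * ennreal (V y) \<partial>count_space S)
    \<le> ennreal (exp (- c * t) * (V x - K) + K)"
  using \<open>x \<in> S\<close> \<open>t \<ge> 0\<close>
proof -
  \<comment> \<open>One application of the recursion to the claimed bound stays below that bound;
    this is the whole inductive step.\<close>
  have split: "ennreal (exp (- exit_rate S q x * t)) * ennreal (V x) +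
      (\<integral>\<^sup>+s\<in>{0..t}. ennreal (exp (- exit_rate S q x * s)) *
         (\<integral>\<^sup>+z. ennreal (q x z) * ennreal (exp (- c * (t - s)) * (V z - K) + K)
           \<partial>count_space (S - {x})) \<partial>lborel)
      \<le> ennreal (exp (- c * t) * (V x - K) + K)" if x: "x \<in> S" and t: "t \<ge> 0" for x t
  proof -
    define Q where "Q = exit_rate S q x"
    define A where "A = (\<integral>\<^sup>+z. ennreal (q x z) * ennreal (V z) \<partial>count_space (S - {x}))"
    have Q0: "Q \<ge> 0" using exit_rate_nonneg[OF R x] by (simp add: Q_def)
    have V0: "V x \<ge> 0" using V x by auto
    have d: "A + ennreal (c * V x) \<le> ennreal (Q * V x + c * K)"
      using drift[OF x] by (simp add: A_def Q_def)
    have "A < \<infinity>"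
      using le_less_trans[OF order_trans[OF _ d] ennreal_less_top] by auto
    then obtain A' where A': "A = ennreal A'" "A' \<ge> 0" by (cases A) auto
    have le: "A' + c * V x \<le> Q * V x + c * K"
      using d V0 Q0 cK A' by (simp add: ennreal_plus[symmetric] del: ennreal_plus)
    \<comment> \<open>An upper bound for the integrand: with \<open>e = exp (- c * (t - s))\<close>,
      the inner sum equals \<open>e * A' + (1 - e) * K * Q\<close>, and \<open>le\<close> bounds
      \<open>A'\<close>.\<close>
    define h where "h s = exp (- Q * s) * (exp (- c * (t - s)) * (Q - c) * (V x - K) + Q * K)" for s
    have inner: "(\<integral>\<^sup>+z. ennreal (q x z) * ennreal (exp (- c * (t - s)) * (V z - K) + K)
           \<partial>count_space (S - {x})) \<le> ennreal (exp (- c * (t - s)) * (Q - c) * (V x - K) + Q * K)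
         \<and> exp (- c * (t - s)) * (Q - c) * (V x - K) + Q * K \<ge> 0"
      if s: "s \<in> {0..t}" for s
    proof -
      define e where "e = exp (- c * (t - s))"
      have "c * (t - s) \<ge> 0" using s cK by auto
      then have e: "0 < e" "e \<le> 1" by (auto simp: e_def)
      have "(\<integral>\<^sup>+z. ennreal (q x z) * ennreal (e * (V z - K) + K) \<partial>count_space (S - {x}))
        = (\<integral>\<^sup>+z. ennreal e * (ennreal (q x z) * ennreal (V z)) + ennreal ((1 - e) * K) * ennreal (q x z)
             \<partial>count_space (S - {x}))"
      proof (intro nn_integral_cong)
        fix z assume "z \<in> space (count_space (S - {x}))"
        then have z: "V z \<ge> 0" "q x z \<ge> 0" using V R x by (auto simp: transition_rates_def)
        have "ennreal (e * (V z - K) + K) = ennreal (e * V z + (1 - e) * K)"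
          by (simp add: algebra_simps)
        also have "\<dots> = ennreal (e * V z) + ennreal ((1 - e) * K)"
          using e z cK by (subst ennreal_plus) auto
        finally show "ennreal (q x z) * ennreal (e * (V z - K) + K) = ennreal e * (ennreal (q x z) * ennreal (V z)) + ennreal ((1 - e) * K) * ennreal (q x z)"
          using e z cK by (simp add: ennreal_mult mult_ac distrib_left)
      qed
      also have "\<dots> = ennreal e * A + ennreal ((1 - e) * K) * ennreal Q"
        by (subst nn_integral_add)
           (simp_all add: nn_integral_cmult A_def Q_def nn_integral_exit_rate[OF R x])
      also have "\<dots> = ennreal (e * A' + (1 - e) * K * Q)"
        using e A' cK Q0 by (subst ennreal_plus) (simp_all add: ennreal_mult)
      finally have eq: "(\<integral>\<^sup>+z. ennreal (q x z) * ennreal (e * (V z - K) + K) \<partial>count_space (S - {x}))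
        = ennreal (e * A' + (1 - e) * K * Q)" .
      have "e * A' \<le> e * (Q * V x + c * K - c * V x)"
        using e le by (intro mult_left_mono) auto
      then have *: "e * A' + (1 - e) * K * Q \<le> e * (Q - c) * (V x - K) + Q * K"
        by (simp add: algebra_simps)
      moreover have "e * A' + (1 - e) * K * Q \<ge> 0"
        using e A' cK Q0 by simp
      ultimately show ?thesis
        unfolding e_def[symmetric] using eq by (auto intro: ennreal_leI)
    qed
    \<comment> \<open>An antiderivative of \<open>h\<close>. Its increment over
      \<open>[0, t]\<close> is the claimed bound minus the no-jump term
      \<open>exp (- Q * t) * V x\<close>, so the two pieces add up exactly.\<close>
    define F where "F s = - exp (- c * t) * exp (- (Q - c) * s) * (V x - K) - K * exp (- Q * s)" for s
    have dF: "(F has_real_derivative h s) (at s)" for s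
    proof -
      have "exp (- Q * s) * exp (- c * (t - s)) = exp (- c * t) * exp (- (Q - c) * s)"
        by (simp add: exp_add[symmetric] algebra_simps)
      moreover have "h s = (exp (- Q * s) * exp (- c * (t - s))) * (Q - c) * (V x - K) + Q * K * exp (- Q * s)"
        unfolding h_def by algebra
      ultimately have "h s = exp (- c * t) * exp (- (Q - c) * s) * (Q - c) * (V x - K) + Q * K * exp (- Q * s)"
        by simp
      then show ?thesis
        unfolding F_def by (auto intro!: derivative_eq_intros simp: algebra_simps)
    qed
    have h0: "h s \<ge> 0" if "s \<in> {0..t}" for s using inner[OF that] by (simp add: h_def)
    have Ft: "F t - F 0 = exp (- c * t) * (V x - K) + K - exp (- Q * t) * V x"
    proof -
      have "exp (- c * t) * exp (- (Q - c) * t) = exp (- Q * t)"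
        by (simp add: exp_add[symmetric] algebra_simps)
      then show ?thesis by (simp add: F_def algebra_simps)
    qed
    have F0: "F 0 \<le> F t"
      by (rule DERIV_nonneg_imp_nondecreasing[OF t]) (meson atLeastAtMost_iff dF h0)
    have "(\<integral>\<^sup>+s\<in>{0..t}. ennreal (exp (- exit_rate S q x * s)) *
         (\<integral>\<^sup>+z. ennreal (q x z) * ennreal (exp (- c * (t - s)) * (V z - K) + K)
           \<partial>count_space (S - {x})) \<partial>lborel) \<le> (\<integral>\<^sup>+s. ennreal (h s) * indicator {0..t} s \<partial>lborel)"
    proof (intro nn_integral_mono)
      fix s :: real
      show "ennreal (exp (- exit_rate S q x * s)) *
         (\<integral>\<^sup>+z. ennreal (q x z) * ennreal (exp (- c * (t - s)) * (V z - K) + K)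
           \<partial>count_space (S - {x})) * indicator {0..t} s \<le> ennreal (h s) * indicator {0..t} s"
        using inner[of s] by (auto split: split_indicator simp: h_def Q_def ennreal_mult mult_left_mono)
    qed
    also have "\<dots> = ennreal (F t - F 0)"
      by (rule nn_integral_FTC_Icc[OF _ dF h0 t]) (simp add: h_def)
    finally have I: "(\<integral>\<^sup>+s\<in>{0..t}. ennreal (exp (- exit_rate S q x * s)) *
         (\<integral>\<^sup>+z. ennreal (q x z) * ennreal (exp (- c * (t - s)) * (V z - K) + K)
           \<partial>count_space (S - {x})) \<partial>lborel)
         \<le> ennreal (F t - F 0)" .
    have "ennreal (exp (- Q * t) * V x) + ennreal (F t - F 0) = ennreal (exp (- c * t) * (V x - K) + K)"
      using V0 F0 Ft by (subst ennreal_plus[symmetric]) auto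
    then show ?thesis
      using add_left_mono[OF I, of "ennreal (exp (- Q * t) * V x)"] V0
      by (simp add: ennreal_mult Q_def)
  qed
  show ?thesis
    using \<open>x \<in> S\<close> \<open>t \<ge> 0\<close>
  proof (induction n arbitrary: x t)
    case (0 x t)
    show ?case
      unfolding jump_prob.simps nn_integral_count_space_delta[OF 0(1)]
      \<comment> \<open>Without jumps only the first summand of \<open>split\<close> is
        present.\<close>
      by (rule order_trans[OF _ split[OF 0]]) simp
  next
    case (Suc n x t)
    have "countable S" using R by (simp add: transition_rates_def)
    have "(\<integral>\<^sup>+s\<in>{0..t}. ennreal (exp (- exit_rate S q x * s)) *
       (\<integral>\<^sup>+z. ennreal (q x z) * (\<integral>\<^sup>+y. jump_prob S q n (t - s) z y * ennreal (V y) \<partial>count_space S)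
          \<partial>count_space (S - {x})) \<partial>lborel)
      \<le> (\<integral>\<^sup>+s\<in>{0..t}. ennreal (exp (- exit_rate S q x * s)) *
         (\<integral>\<^sup>+z. ennreal (q x z) * ennreal (exp (- c * (t - s)) * (V z - K) + K)
           \<partial>count_space (S - {x})) \<partial>lborel)"
    proof (intro nn_integral_mono)
      fix s :: real
      show "ennreal (exp (- exit_rate S q x * s)) *
       (\<integral>\<^sup>+z. ennreal (q x z) * (\<integral>\<^sup>+y. jump_prob S q n (t - s) z y * ennreal (V y) \<partial>count_space S)
          \<partial>count_space (S - {x})) * indicator {0..t} s \<le> ennreal (exp (- exit_rate S q x * s)) *
         (\<integral>\<^sup>+z. ennreal (q x z) * ennreal (exp (- c * (t - s)) * (V z - K) + K)
           \<partial>count_space (S - {x})) * indicator {0..t} s"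
        by (cases "s \<in> {0..t}") (auto intro!: mult_left_mono nn_integral_mono Suc.IH[simplified])
    qed
    then show ?case
      unfolding nn_integral_jump_prob_Suc[OF \<open>countable S\<close> Suc.prems(1)]
      by (rule order_trans[OF add_left_mono split[OF Suc.prems]])
  qed
qed

lemma transition_prob_drift_bound:
  fixes V :: "'s \<Rightarrow> real"
  assumes "transition_rates S q"
    and "\<And>x. x \<in> S \<Longrightarrow> V x \<ge> 0"
    and "c > 0" "K \<ge> 0"
    and "\<And>x. x \<in> S \<Longrightarrow>
      (\<integral>\<^sup>+z. ennreal (q x z) * ennreal (V z) \<partial>count_space (S - {x})) + ennreal (c * V x)
        \<le> ennreal (exit_rate S q x * V x + c * K)"
    and "x \<in> S" "t \<ge> 0"
  shows "(\<integral>\<^sup>+y. transition_prob S q t x y * ennreal (V y) \<partial>count_space S)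
    \<le> ennreal (exp (- c * t) * (V x - K) + K)"
proof -
  have "(\<integral>\<^sup>+y. transition_prob S q t x y * ennreal (V y) \<partial>count_space S) =
      (\<integral>\<^sup>+y. (SUP n. jump_prob S q n t x y * ennreal (V y)) \<partial>count_space S)"
    by (simp add: transition_prob_def SUP_mult_right_ennreal)
  also have "\<dots> = (SUP n. \<integral>\<^sup>+y. jump_prob S q n t x y * ennreal (V y) \<partial>count_space S)"
    by (intro nn_integral_monotone_convergence_SUP incseq_SucI le_funI mult_right_mono jump_prob_mono) auto
  also have "\<dots> \<le> ennreal (exp (- c * t) * (V x - K) + K)"
    using jump_prob_drift_bound[OF assms] by (intro SUP_least)
  finally show ?thesis .
qed

text \<open>The constant function 1 satisfies the drift condition with \<open>c = K = 1\<close>, and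
  the bound then equals 1 at all times.\<close>

lemma transition_prob_sum_le_1:
  assumes R: "transition_rates S q" and "x \<in> S" "t \<ge> 0"
  shows "(\<integral>\<^sup>+y. transition_prob S q t x y \<partial>count_space S) \<le> 1"
  using transition_prob_drift_bound[OF R, of "\<lambda>_. 1" 1 1, OF _ _ _ _ assms(2,3)]
  by (simp add: nn_integral_exit_rate[OF R] exit_rate_nonneg[OF R])

text \<open>Invariance of the point masses extends to every nonnegative \<open>g\<close> by Tonelli,
  with no integrability assumption.\<close>

lemma stationary_nn_integral:
  assumes R: "transition_rates S q" and stat: "stationary_distribution S q p" and "t \<ge> 0"
  shows "(\<integral>\<^sup>+x. g x \<partial>measure_pmf p) =
    (\<integral>\<^sup>+x. (\<integral>\<^sup>+y. transition_prob S q t x y * g y \<partial>count_space S) \<partial>measure_pmf p)"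
proof -
  have S: "countable S" "set_pmf p \<subseteq> S"
    using R stat by (auto simp: transition_rates_def stationary_distribution_def)
  have "(\<integral>\<^sup>+x. g x \<partial>measure_pmf p) = (\<integral>\<^sup>+y. ennreal (pmf p y) * g y \<partial>count_space S)"
    unfolding nn_integral_measure_pmf using S
    by (intro nn_integral_count_space_eq) (auto simp: pmf_eq_0_set_pmf)
  also have "\<dots> = (\<integral>\<^sup>+y. (\<integral>\<^sup>+x. transition_prob S q t x y * g y \<partial>measure_pmf p) \<partial>count_space S)"
    using stat \<open>t \<ge> 0\<close>
    by (intro nn_integral_cong) (simp add: stationary_distribution_def nn_integral_multc)
  also have "\<dots> = (\<integral>\<^sup>+x. (\<integral>\<^sup>+y. transition_prob S q t x y * g y \<partial>count_space S) \<partial>measure_pmf p)"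
    using S by (intro nn_integral_count_space_nn_integral[symmetric]) auto
  finally show ?thesis .
qed

text \<open>The function \<open>V\<close> is not known to be integrable, so stationarity is applied to its
  truncations.\<close>

lemma stationary_drift_bound:
  fixes V :: "'s \<Rightarrow> real"
  assumes R: "transition_rates S q"
    and V: "\<And>x. x \<in> S \<Longrightarrow> V x \<ge> 0"
    and cK: "c > 0" "K \<ge> 0"
    and drift: "\<And>x. x \<in> S \<Longrightarrow>
      (\<integral>\<^sup>+z. ennreal (q x z) * ennreal (V z) \<partial>count_space (S - {x})) + ennreal (c * V x)
        \<le> ennreal (exit_rate S q x * V x + c * K)"
    and stat: "stationary_distribution S q p"
  shows "(\<integral>\<^sup>+x. ennreal (V x) \<partial>measure_pmf p) \<le> ennreal K"
proof -
  have S: "set_pmf p \<subseteq> S" using stat by (auto simp: stationary_distribution_def)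
  have trunc: "(\<integral>\<^sup>+x. ennreal (min (V x) (real M)) \<partial>measure_pmf p) \<le> ennreal K" for M :: nat
  proof -
    \<comment> \<open>At time \<open>n\<close> the truncated expectation from \<open>x\<close> obeys
      two bounds: the drift bound, and \<open>M\<close> because the total mass is at most 1.\<close>
    define u where "u n x = ennreal (min (exp (- c * real n) * (V x - K) + K) (real M))" for n x
    have le: "(\<integral>\<^sup>+x. ennreal (min (V x) (real M)) \<partial>measure_pmf p) \<le> (\<integral>\<^sup>+x. u n x \<partial>measure_pmf p)" for n
    proof -
      have "(\<integral>\<^sup>+y. transition_prob S q (real n) x y * ennreal (min (V y) (real M)) \<partial>count_space S) \<le> u n x"
        if "x \<in> S" for x
      proof -
        have "(\<integral>\<^sup>+y. transition_prob S q (real n) x y * ennreal (min (V y) (real M)) \<partial>count_space S)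
          \<le> (\<integral>\<^sup>+y. transition_prob S q (real n) x y * ennreal (V y) \<partial>count_space S)"
          by (intro nn_integral_mono mult_left_mono ennreal_leI) auto
        also have "\<dots> \<le> ennreal (exp (- c * real n) * (V x - K) + K)"
          by (rule transition_prob_drift_bound[OF R V cK drift that]) auto
        finally have 1: "(\<integral>\<^sup>+y. transition_prob S q (real n) x y * ennreal (min (V y) (real M)) \<partial>count_space S)
          \<le> ennreal (exp (- c * real n) * (V x - K) + K)" .
        have "(\<integral>\<^sup>+y. transition_prob S q (real n) x y * ennreal (min (V y) (real M)) \<partial>count_space S)
          \<le> (\<integral>\<^sup>+y. transition_prob S q (real n) x y * ennreal (real M) \<partial>count_space S)"
          by (intro nn_integral_mono mult_left_mono ennreal_leI) auto
        also have "\<dots> = (\<integral>\<^sup>+y. transition_prob S q (real n) x y \<partial>count_space S) * ennreal (real M)"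
          by (rule nn_integral_multc) auto
        also have "\<dots> \<le> 1 * ennreal (real M)"
          by (intro mult_right_mono transition_prob_sum_le_1[OF R that]) auto
        finally show ?thesis using 1 by (auto simp: u_def min_def)
      qed
      then show ?thesis
        using S by (subst stationary_nn_integral[OF R stat of_nat_0_le_iff[of n]])
          (intro nn_integral_mono_AE, simp add: AE_measure_pmf_iff subset_iff)
    qed
    \<comment> \<open>The bound by \<open>M\<close> is the dominating function, so the dependence on
      the starting value \<open>V x\<close> disappears in the limit even if \<open>V\<close> is not
      integrable.\<close>
    have "(\<lambda>n. \<integral>\<^sup>+x. u n x \<partial>measure_pmf p) \<longlonglongrightarrow> (\<integral>\<^sup>+x. ennreal (min K (real M)) \<partial>measure_pmf p)"
    proof (rule nn_integral_dominated_convergence[where w = "\<lambda>_. ennreal (real M)"])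
      show "AE x in measure_pmf p. (\<lambda>n. u n x) \<longlonglongrightarrow> ennreal (min K (real M))"
      proof (intro AE_I2)
        fix x
        have "(\<lambda>n. exp (- c * real n)) \<longlonglongrightarrow> 0"
          using cK by real_asymp
        then have "(\<lambda>n. min (exp (- c * real n) * (V x - K) + K) (real M)) \<longlonglongrightarrow> min (0 * (V x - K) + K) (real M)"
          by (intro tendsto_intros)
        then show "(\<lambda>n. u n x) \<longlonglongrightarrow> ennreal (min K (real M))"
          unfolding u_def by (intro tendsto_ennrealI) simp
      qed
    qed (auto simp: u_def intro!: ennreal_leI)
    then have "(\<integral>\<^sup>+x. ennreal (min (V x) (real M)) \<partial>measure_pmf p) \<le> (\<integral>\<^sup>+x. ennreal (min K (real M)) \<partial>measure_pmf p)"
      by (rule LIMSEQ_le_const) (use le in auto)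
    also have "\<dots> \<le> ennreal K" by (auto intro!: ennreal_leI)
    finally show ?thesis .
  qed
  have "ennreal (V x) \<le> (SUP M::nat. ennreal (min (V x) (real M)))" for x
  proof -
    obtain M :: nat where "V x \<le> real M" using real_arch_simple by blast
    then show ?thesis by (intro SUP_upper2[of M]) auto
  qed
  then have "(\<integral>\<^sup>+x. ennreal (V x) \<partial>measure_pmf p) \<le> (\<integral>\<^sup>+x. (SUP M::nat. ennreal (min (V x) (real M))) \<partial>measure_pmf p)"
    by (intro nn_integral_mono)
  also have "\<dots> = (SUP M::nat. \<integral>\<^sup>+x. ennreal (min (V x) (real M)) \<partial>measure_pmf p)"
    by (intro nn_integral_monotone_convergence_SUP incseq_SucI le_funI ennreal_leI) auto
  also have "\<dots> \<le> ennreal K" by (intro SUP_least trunc)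
  finally show ?thesis .
qed

section \<open>Drift of functions of the class counts\<close>

text \<open>The jumps that change the counts fall into disjoint classes, one for each customer class
  and direction, and \<open>G\<close> is constant on each. Jumps inside a fibre of the counts
  contribute nothing, so the policy enters only through \<open>P\<close>.\<close>

lemma service_system_generator:
  fixes G :: "('i::finite \<Rightarrow> nat) \<Rightarrow> real"
  assumes ss: "service_system a lam mu nu r S q f" and x: "x \<in> S"
    and Z: "Z = fst (f x)" and P: "P = snd (f x)"
  shows "((\<lambda>y. q x y * (G (fst (f y)) - G Z)) has_sum
    (\<Sum>l\<in>UNIV. lam l * real r * (G (Z(l := Z l + 1)) - G Z) +
       (mu l * real (P l) + nu l * (real (Z l) - real (P l))) * (G (Z(l := Z l - 1)) - G Z))) (S - {x})"
proof -
  define z where "z y = fst (f y)" for y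
  have zx: "z x = Z" by (simp add: z_def Z)
  have le: "P i \<le> Z i" for i
    using ss x unfolding service_system_def by (simp add: Z P)
  have up: "(q x has_sum lam l * real r) {y \<in> S. z y = Z(l := Z l + 1)}" for l
    using ss x unfolding service_system_def by (simp add: Z z_def)
  have down: "(q x has_sum mu l * real (P l) + nu l * (real (Z l) - real (P l)))
      {y \<in> S. z y = Z(l := Z l - 1)}" if "Z l \<ge> 1" for l
    using ss x that unfolding service_system_def by (simp add: Z P z_def)
  have zero: "q x y = 0" if "y \<in> S" "(\<exists>i. \<bar>int (z y i) - int (Z i)\<bar> > 1) \<or> card {i. z y i \<noteq> Z i} > 1" for y
    using ss x that unfolding service_system_def Let_def Z z_def by blast
  \<comment> \<open>The downward class is empty when \<open>Z l = 0\<close>: truncated subtraction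
    would otherwise make it the fibre of \<open>Z\<close> itself and destroy disjointness. The
    corresponding summand is 0 because then \<open>P l = 0\<close>.\<close>
  define B where "B = (\<lambda>(l, b). if b then {y \<in> S. z y = Z(l := Z l + 1)}
     else if Z l \<ge> 1 then {y \<in> S. z y = Z(l := Z l - 1)} else {})"
  define s where "s = (\<lambda>(l, b). if b then lam l * real r * (G (Z(l := Z l + 1)) - G Z)
     else (mu l * real (P l) + nu l * (real (Z l) - real (P l))) * (G (Z(l := Z l - 1)) - G Z))"
  let ?h = "\<lambda>y. q x y * (G (z y) - G Z)"
  have part: "(?h has_sum s k) (B k)" for k
  proof (cases k)
    case (Pair l b)
    show ?thesis
    proof (cases "\<not> b \<and> Z l = 0")
      case True
      then show ?thesis using le[of l] by (simp add: Pair B_def s_def)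
    next
      case False
      define v where "v = (if b then Z(l := Z l + 1) else Z(l := Z l - 1))"
      define w where "w = (if b then lam l * real r else mu l * real (P l) + nu l * (real (Z l) - real (P l)))"
      have B: "B k = {y \<in> S. z y = v}" using False by (auto simp: B_def Pair v_def)
      have "(q x has_sum w) (B k)"
        using up[of l] down[of l] False unfolding B v_def w_def by auto
      then have "((\<lambda>y. q x y * (G v - G Z)) has_sum w * (G v - G Z)) (B k)"
        by (rule has_sum_cmult_left)
      moreover have "w * (G v - G Z) = s k" by (simp add: w_def v_def s_def Pair)
      ultimately show ?thesis
        by (subst has_sum_cong[of _ _ "\<lambda>y. q x y * (G v - G Z)"]) (auto simp: B)
    qed
  qed
  have disj: "B k \<inter> B k' = {}" if "k \<noteq> k'" for k k'
  proof -
    have key: "(l, b) = (l', b')" if e: "y \<in> B (l, b)" "y \<in> B (l', b')" for y l b l' b'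
    proof -
      have *: "z y l = (if b then Z l + 1 else Z l - 1) \<and> z y l \<noteq> Z l \<and> (\<forall>j. j \<noteq> l \<longrightarrow> z y j = Z j)"
        if "y \<in> B (l, b)" for l b
        using that by (auto simp: B_def split: if_splits)
      have "l = l'" using *[OF e(1)] *[OF e(2)] by metis
      then show ?thesis using *[OF e(1)] *[OF e(2)] by (auto split: if_splits)
    qed
    then show ?thesis using that by (cases k, cases k') blast
  qed
  have "(?h has_sum (\<Sum>k\<in>UNIV. s k)) (\<Union>k\<in>UNIV. B k)"
    by (rule sum_has_sum) (use part disj in auto)
  \<comment> \<open>The two index sets differ only where the summand vanishes, either because the
    counts are unchanged or because the rate is 0.\<close>
  moreover have "(?h has_sum (\<Sum>k\<in>UNIV. s k)) (\<Union>k\<in>UNIV. B k) \<longleftrightarrow>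
      (?h has_sum (\<Sum>k\<in>UNIV. s k)) (S - {x})"
  proof (rule has_sum_cong_neutral)
    fix y assume "y \<in> (\<Union>k\<in>UNIV. B k) - (S - {x})"
    then have "y = x" "\<exists>k. y \<in> B k" by (auto simp: B_def split: if_splits)
    then show "?h y = 0" by (simp add: zx)
  next
    fix y assume y: "y \<in> S - {x} - (\<Union>k\<in>UNIV. B k)"
    show "?h y = 0"
    proof (rule ccontr)
      assume "?h y \<noteq> 0"
      then have q: "q x y \<noteq> 0" and "z y \<noteq> Z" by auto
      then obtain l where l: "z y l \<noteq> Z l" by blast
      have *: "\<bar>int (z y i) - int (Z i)\<bar> \<le> 1" "card {i. z y i \<noteq> Z i} \<le> 1" for i
        using zero[of y] y q by (meson DiffD1 not_le)+
      have "{i. z y i \<noteq> Z i} \<subseteq> {l}"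
        using *(2) l by (metis (mono_tags, lifting) card_le_Suc0_iff_eq finite mem_Collect_eq
            One_nat_def insertI1 subsetI)
      then have "z y = Z(l := z y l)" by (intro ext) auto
      moreover have "z y l = Z l + 1 \<or> (Z l \<ge> 1 \<and> z y l = Z l - 1)"
        using *(1)[of l] l by linarith
      ultimately have "y \<in> B (l, True) \<or> y \<in> B (l, False)"
        using y by (auto simp: B_def)
      then show False using y by auto
    qed
  qed simp
  moreover have "(\<Sum>k\<in>UNIV. s k) = (\<Sum>l\<in>UNIV. lam l * real r * (G (Z(l := Z l + 1)) - G Z) +
       (mu l * real (P l) + nu l * (real (Z l) - real (P l))) * (G (Z(l := Z l - 1)) - G Z))"
    unfolding UNIV_Times_UNIV[symmetric] sum.cartesian_product' by (simp add: s_def UNIV_bool add.commute)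
  ultimately show ?thesis by (simp add: z_def)
qed

text \<open>The generator sum is signed, while the drift criterion uses nonnegative integrals.
  Adding \<open>exit_rate S q x * g x\<close> turns one form into the other.\<close>

lemma service_system_drift_bound:
  fixes G :: "('i::finite \<Rightarrow> nat) \<Rightarrow> real"
  assumes ss: "service_system a lam mu nu r S q f"
    and stat: "stationary_distribution S q p"
    and G: "\<And>z. G z \<ge> 0" and cK: "c > 0" "K \<ge> 0"
    and drift: "\<And>x Z P. x \<in> S \<Longrightarrow> Z = fst (f x) \<Longrightarrow> P = snd (f x) \<Longrightarrow>
      (\<Sum>l\<in>UNIV. lam l * real r * (G (Z(l := Z l + 1)) - G Z) +
         (mu l * real (P l) + nu l * (real (Z l) - real (P l))) * (G (Z(l := Z l - 1)) - G Z))
      \<le> c * K - c * G Z"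
  shows "(\<integral>\<^sup>+x. ennreal (G (fst (f x))) \<partial>measure_pmf p) \<le> ennreal K"
proof (rule stationary_drift_bound[OF _ _ cK _ stat])
  show R: "transition_rates S q" using ss by (simp add: service_system_def)
  show "(\<integral>\<^sup>+z. ennreal (q x z) * ennreal (G (fst (f z))) \<partial>count_space (S - {x})) + ennreal (c * G (fst (f x)))
        \<le> ennreal (exit_rate S q x * G (fst (f x)) + c * K)" if x: "x \<in> S" for x
  proof -
    define g where "g y = G (fst (f y))" for y
    obtain D where D: "((\<lambda>y. q x y * (g y - g x)) has_sum D) (S - {x})" and le: "D \<le> c * K - c * g x"
      using service_system_generator[OF ss x refl refl, of G] drift[OF x refl refl]
      unfolding g_def by blast
    have q0: "q x y \<ge> 0" if "y \<in> S - {x}" for y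
      using R x that by (auto simp: transition_rates_def)
    have "(q x has_sum exit_rate S q x) (S - {x})"
      using R x unfolding transition_rates_def exit_rate_def by auto
    from has_sum_add[OF D has_sum_cmult_left[OF this, of "g x"]]
    have sum: "((\<lambda>y. q x y * g y) has_sum (D + exit_rate S q x * g x)) (S - {x})"
      by (simp add: algebra_simps)
    have g0: "g y \<ge> 0" for y by (simp add: g_def G)
    have "(\<integral>\<^sup>+z. ennreal (q x z) * ennreal (g z) \<partial>count_space (S - {x})) =
        (\<integral>\<^sup>+z. ennreal (q x z * g z) \<partial>count_space (S - {x}))"
      using q0 g0 by (intro nn_integral_cong) (simp add: ennreal_mult)
    also have "\<dots> = ennreal (D + exit_rate S q x * g x)"
      using q0 g0 by (intro nn_integral_count_space_has_sum[OF sum]) simp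
    finally have eq: "(\<integral>\<^sup>+z. ennreal (q x z) * ennreal (g z) \<partial>count_space (S - {x})) =
      ennreal (D + exit_rate S q x * g x)" .
    have "D + exit_rate S q x * g x \<ge> 0"
      using q0 g0 by (intro has_sum_nonneg[OF sum]) simp
    then have "ennreal (D + exit_rate S q x * g x) + ennreal (c * g x)
       = ennreal (D + exit_rate S q x * g x + c * g x)"
      using g0[of x] cK by (simp add: ennreal_plus)
    also have "\<dots> \<le> ennreal (exit_rate S q x * g x + c * K)"
      using le by (intro ennreal_leI) simp
    finally show ?thesis using eq by (simp add: g_def)
  qed
qed (use G in auto)

section \<open>One-dimensional drift estimates\<close>

lemma exp_le_quadratic:
  assumes "x \<le> (1::real)"
  shows "exp x - 1 \<le> x + x\<^sup>2"
proof (cases "x \<ge> 0")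
  case True
  then show ?thesis using exp_bound[of x] assms by simp
next
  case False
  define y where "y = - x"
  have y: "y > 0" using False by (simp add: y_def)
  have "1 + y + y\<^sup>2 / 2 \<le> exp y" using y by (intro exp_lower_Taylor_quadratic) simp
  moreover have "(1 - y + y\<^sup>2) > 0"
    using sum_squares_ge_zero[of "y - 1" y] y by (sos)
  \<comment> \<open>For \<open>y = - x > 0\<close> it suffices that
    \<open>(1 - y + y\<^sup>2) * exp y\<close> is at least 1; the quadratic Taylor polynomial of
    \<open>exp y\<close> already achieves this.\<close>
  ultimately have "(1 - y + y\<^sup>2) * (1 + y + y\<^sup>2 / 2) \<le> (1 - y + y\<^sup>2) * exp y"
    by (intro mult_left_mono) auto
  moreover have "(1 - y + y\<^sup>2) * (1 + y + y\<^sup>2 / 2) = 1 + y\<^sup>2 / 2 + y ^ 3 / 2 + y ^ 4 / 2"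
    by (simp add: power2_eq_square power3_eq_cube power4_eq_xxxx field_simps)
  ultimately have "1 \<le> (1 - y + y\<^sup>2) * exp y"
    using y by (smt (verit) zero_le_power divide_nonneg_nonneg)
  then have "exp (- y) \<le> 1 - y + y\<^sup>2"
    by (simp add: exp_minus inverse_eq_divide divide_le_eq)
  then show ?thesis by (simp add: y_def)
qed

lemma exp_minus_one_le:
  "exp x - 1 \<le> x * exp (x::real)"
proof -
  have "1 - x \<le> exp (- x)" using exp_ge_add_one_self[of "- x"] by simp
  then have "(1 - x) * exp x \<le> 1" by (simp add: exp_minus field_simps)
  then show ?thesis by (simp add: algebra_simps)
qed

text \<open>The left side is the symmetric second difference left over when upward and downward
  rates agree; it factors as \<open>exp (- x) * (exp x - 1)\<^sup>2\<close>.\<close>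

lemma exp_add_exp_minus_le:
  assumes "x \<ge> (0::real)"
  shows "exp x + exp (- x) - 2 \<le> x\<^sup>2 * exp x"
proof -
  have "exp x + exp (- x) - 2 = exp (- x) * (exp x - 1)\<^sup>2"
    by (simp add: power2_eq_square algebra_simps exp_minus)
  also have "(exp x - 1)\<^sup>2 \<le> (x * exp x)\<^sup>2"
    using exp_minus_one_le[of x] assms by (intro power_mono) auto
  also have "exp (- x) * (x * exp x)\<^sup>2 = x\<^sup>2 * exp x"
    by (simp add: power2_eq_square algebra_simps exp_minus)
  finally show ?thesis by simp
qed

text \<open>Here \<open>d\<close> stands for \<open>1 / sqrt r\<close> and \<open>D\<close> for the
  departure rate, compared with that of an infinite-server queue. Far below zero the restoring term
  makes the bracket negative; elsewhere the product is bounded. The constant \<open>K\<close> is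
  chosen before \<open>d\<close> and \<open>r\<close>, hence is uniform in them.\<close>

lemma down_drift_exp:
  fixes lam mu \<theta> :: real
  assumes lm: "lam > 0" "mu > 0" and \<theta>: "\<theta> > 0"
  shows "\<exists>K>0. \<forall>d r Z D z. 0 < d \<longrightarrow> d \<le> 1 \<longrightarrow> r * d\<^sup>2 = 1 \<longrightarrow> D \<le> mu * Z \<longrightarrow> z = (Z - lam / mu * r) * d \<longrightarrow>
    exp (- \<theta> * z) * (lam * r * (exp (- \<theta> * d) - 1) + D * (exp (\<theta> * d) - 1)) \<le> K - exp (- \<theta> * z)"
proof -
  \<comment> \<open>The first summand bounds the second-order part; the extra 1 pays for the term
    \<open>- exp (- \<theta> * z)\<close> in the conclusion.\<close>
  define C where "C = lam * \<theta>\<^sup>2 * exp \<theta> + 1"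
  have C: "C > 0" using lm by (simp add: C_def add_nonneg_pos)
  \<comment> \<open>For \<open>z \<ge> 0\<close> the value \<open>C + mu * exp \<theta>\<close>
    suffices, since \<open>\<theta> * z * exp (- (\<theta> * z)) \<le> 1\<close>. The last summand
    serves negative \<open>z\<close> with \<open>C + mu * \<theta> * z > 0\<close>, where
    \<open>- \<theta> * z < C / mu\<close>.\<close>
  define K where "K = C + mu * exp \<theta> + C * exp (C / mu)"
  have main: "exp (- \<theta> * z) * (lam * r * (exp (- \<theta> * d) - 1) + D * (exp (\<theta> * d) - 1)) \<le> K - exp (- \<theta> * z)"
    if d: "0 < d" "d \<le> 1" and r: "r * d\<^sup>2 = 1" and D: "D \<le> mu * Z" and z: "z = (Z - lam / mu * r) * d"
    for d r Z D z
  proof -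
    define h where "h = \<theta> * d"
    have h: "0 < h" "h \<le> \<theta>" using d \<theta> by (auto simp: h_def mult_left_le)
    have r0: "r > 0" using r d by (metis zero_less_mult_pos2 zero_less_one zero_less_power)
    have rd: "r * d = 1 / d" using r d by (simp add: field_simps power2_eq_square)
    \<comment> \<open>The part \<open>lam * r\<close> of the departure rate balances the arrivals up
      to second order; the rest is the restoring force.\<close>
    have muZ: "mu * Z = lam * r + mu * z / d" using z d lm by (simp add: field_simps)
    have "D * (exp h - 1) \<le> mu * Z * (exp h - 1)"
      using D h by (intro mult_right_mono) auto
    then have "lam * r * (exp (- h) - 1) + D * (exp h - 1) \<le>
        lam * r * (exp h + exp (- h) - 2) + mu * z / d * (exp h - 1)"
      unfolding muZ by (simp add: algebra_simps)
    also have "lam * r * (exp h + exp (- h) - 2) \<le> lam * r * (h\<^sup>2 * exp h)"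
      using lm r0 h by (intro mult_left_mono exp_add_exp_minus_le) auto
    also have "lam * r * (h\<^sup>2 * exp h) = lam * \<theta>\<^sup>2 * exp h * (r * d\<^sup>2)"
      by (simp add: h_def power_mult_distrib)
    also have "\<dots> \<le> lam * \<theta>\<^sup>2 * exp \<theta>"
      unfolding r using lm h by (simp add: mult_left_mono)
    finally have T: "lam * r * (exp (- h) - 1) + D * (exp h - 1) + 1 \<le> C + mu * z / d * (exp h - 1)"
      by (simp add: C_def)
    have "exp (- \<theta> * z) * (lam * r * (exp (- h) - 1) + D * (exp h - 1) + 1) \<le> K"
    proof (cases "z \<ge> 0")
      case True
      have "(exp h - 1) / d \<le> h * exp h / d"
        using exp_minus_one_le[of h] d by (intro divide_right_mono) auto
      also have "\<dots> \<le> \<theta> * exp \<theta>"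
        using h d \<theta> by (simp add: h_def)
      finally have "mu * z * ((exp h - 1) / d) \<le> mu * z * (\<theta> * exp \<theta>)"
        using True lm by (intro mult_left_mono) auto
      then have "exp (- \<theta> * z) * (lam * r * (exp (- h) - 1) + D * (exp h - 1) + 1) \<le>
          exp (- \<theta> * z) * (C + mu * z * (\<theta> * exp \<theta>))"
        using T by (intro mult_left_mono) auto
      also have "\<dots> = exp (- \<theta> * z) * C + mu * exp \<theta> * ((\<theta> * z) * exp (- (\<theta> * z)))"
        by (simp add: algebra_simps)
      also have "exp (- \<theta> * z) * C \<le> 1 * C"
        using True \<theta> C by (intro mult_right_mono) auto
      also have "(\<theta> * z) * exp (- (\<theta> * z)) \<le> exp (\<theta> * z) * exp (- (\<theta> * z))"
        using exp_ge_add_one_self[of "\<theta> * z"] by (intro mult_right_mono) (linarith, simp)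
      also have "exp (\<theta> * z) * exp (- (\<theta> * z)) = 1" by (simp add: exp_minus)
      finally have "exp (- \<theta> * z) * (lam * r * (exp (- h) - 1) + D * (exp h - 1) + 1) \<le> C + mu * exp \<theta>"
        using lm by simp
      also have "\<dots> \<le> K" using C by (simp add: K_def)
      finally show ?thesis .
    next
      case False
      have "mu * z / d * (exp h - 1) \<le> mu * z / d * h"
      proof (rule mult_left_mono_neg)
        show "h \<le> exp h - 1" using exp_ge_add_one_self[of h] by linarith
        show "mu * z / d \<le> 0" using False lm d by (auto simp: divide_nonpos_pos mult_nonneg_nonpos)
      qed
      also have "\<dots> = mu * \<theta> * z" using d by (simp add: h_def)
      finally have T': "lam * r * (exp (- h) - 1) + D * (exp h - 1) + 1 \<le> C + mu * \<theta> * z"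
        using T by simp
      show ?thesis
      proof (cases "C + mu * \<theta> * z \<le> 0")
        case True
        then have "exp (- \<theta> * z) * (lam * r * (exp (- h) - 1) + D * (exp h - 1) + 1) \<le> 0"
          using T' by (intro mult_nonneg_nonpos) auto
        then show ?thesis using C lm by (smt (verit) K_def exp_gt_zero mult_pos_pos)
      next
        case F: False
        have "exp (- \<theta> * z) * (lam * r * (exp (- h) - 1) + D * (exp h - 1) + 1) \<le> exp (- \<theta> * z) * C"
          using T' False lm \<theta> mult_pos_neg[of "mu * \<theta>" z] by (intro mult_left_mono) auto
        also have "\<dots> \<le> exp (C / mu) * C"
          using F lm C by (intro mult_right_mono) (auto simp: field_simps)
        also have "\<dots> \<le> K" using C lm by (simp add: K_def)
        finally show ?thesis .
      qed
    qed
    then show ?thesis by (simp add: h_def algebra_simps)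
  qed
  have "K > 0" using C lm by (simp add: K_def add_pos_pos)
  then show ?thesis using main by blast
qed

section \<open>Calculus of the smoothed potential and the drift of one class\<close>

text \<open>
  A convex \<open>C\<^sup>1\<close> version of the positive part with derivative \<open>soft_step k\<close>. Its curvature is at most
  \<open>1 / k\<close>: the kink of the positive part itself would contribute a drift of order \<open>sqrt r\<close>, and the
  contribution of order \<open>1 / k\<close> has to be small compared with the negative drift \<open>- a\<close>.
\<close>

definition soft_pos :: "real \<Rightarrow> real \<Rightarrow> real" where
  "soft_pos k z = ((max 0 (z + k))\<^sup>2 - (max 0 z)\<^sup>2) / (2 * k)"

definition soft_step :: "real \<Rightarrow> real \<Rightarrow> real" where
  "soft_step k z = (max 0 (z + k) - max 0 z) / k"

text \<open>The squared positive part is \<open>C\<^sup>1\<close> with derivative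
  \<open>2 * max 0 y\<close> and curvature between 0 and 2; the claim is its two-sided Taylor
  estimate.\<close>

lemma sq_max_expansion:
  fixes y h :: real
  shows "(max 0 (y + h))\<^sup>2 - (max 0 y)\<^sup>2 - 2 * h * max 0 y \<in> {0..h\<^sup>2}"
proof -
  consider "y \<ge> 0" "y + h \<ge> 0" | "y \<ge> 0" "y + h < 0" | "y < 0" "y + h \<ge> 0" | "y < 0" "y + h < 0"
    by linarith
  then show ?thesis
  proof cases
    case 1
    then show ?thesis by (simp add: power2_eq_square algebra_simps)
  next
    case 2
    have "y * (- y - 2 * h) \<ge> 0" using 2 by (intro mult_nonneg_nonneg) auto
    moreover have "(y + h)\<^sup>2 \<ge> 0" by simp
    ultimately show ?thesis using 2 by (simp add: power2_eq_square algebra_simps)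
  next
    case 3
    then show ?thesis by (auto intro!: power_mono)
  next
    case 4
    then show ?thesis by simp
  qed
qed

text \<open>Combines the upper estimate of \<open>sq_max_expansion\<close> at \<open>z + k\<close>
  with the lower one at \<open>z\<close>.\<close>

lemma soft_pos_taylor:
  assumes "k > 0"
  shows "soft_pos k (z + h) - soft_pos k z \<le> soft_step k z * h + h\<^sup>2 / (2 * k)"
proof -
  have "2 * k * (soft_pos k (z + h) - soft_pos k z) =
     ((max 0 (z + k + h))\<^sup>2 - (max 0 (z + k))\<^sup>2) - ((max 0 (z + h))\<^sup>2 - (max 0 z)\<^sup>2)"
    using assms by (simp add: soft_pos_def field_simps add_ac)
  also have "\<dots> \<le> 2 * h * (max 0 (z + k) - max 0 z) + h\<^sup>2"
    using sq_max_expansion[of "z + k" h] sq_max_expansion[of z h] by (simp add: algebra_simps)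
  also have "\<dots> = 2 * k * (soft_step k z * h + h\<^sup>2 / (2 * k))"
    using assms by (simp add: soft_step_def field_simps)
  finally show ?thesis using assms by simp
qed

lemma soft_pos_mono:
  assumes "k > 0" "x \<le> y"
  shows "soft_pos k x \<le> soft_pos k y"
proof -
  \<comment> \<open>Both factors are nonnegative and nondecreasing in \<open>z\<close>, so the
    product is nondecreasing.\<close>
  have eq: "(max 0 (z + k))\<^sup>2 - (max 0 z)\<^sup>2 = (max 0 (z + k) - max 0 z) * (max 0 (z + k) + max 0 z)" for z :: real
    by (simp add: power2_eq_square algebra_simps)
  have "(max 0 (x + k) - max 0 x) * (max 0 (x + k) + max 0 x) \<le> (max 0 (y + k) - max 0 y) * (max 0 (y + k) + max 0 y)"
    using assms by (intro mult_mono) auto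
  then show ?thesis
    using assms unfolding soft_pos_def eq by (intro divide_right_mono) auto
qed

text \<open>A symmetry about \<open>- k / 2\<close>, analogous to
  \<open>max 0 z = z + max 0 (- z)\<close>. It converts monotonicity into the slope bound 1 and
  nonnegativity into the lower bound by \<open>z\<close>.\<close>

lemma soft_pos_reflect:
  assumes "k > 0"
  shows "soft_pos k z = z + k / 2 + soft_pos k (- z - k)"
proof -
  have eq: "(max 0 y)\<^sup>2 = y\<^sup>2 - (max 0 (- y))\<^sup>2" for y :: real by (simp add: max_def)
  have "(max 0 (z + k))\<^sup>2 - (max 0 z)\<^sup>2 = (z + k)\<^sup>2 - z\<^sup>2 + ((max 0 (- z))\<^sup>2 - (max 0 (- z - k))\<^sup>2)"
    using eq[of "z + k"] eq[of z] unfolding minus_add_distrib by simp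
  then have "soft_pos k z = ((z + k)\<^sup>2 - z\<^sup>2) / (2 * k) + soft_pos k (- z - k)"
    by (simp add: soft_pos_def add_divide_distrib)
  also have "((z + k)\<^sup>2 - z\<^sup>2) / (2 * k) = z + k / 2"
    using assms by (simp add: field_simps power2_eq_square)
  finally show ?thesis by simp
qed

lemma soft_pos_increment_le:
  assumes "k > 0" "x \<le> y"
  shows "soft_pos k y - soft_pos k x \<le> y - x"
  using soft_pos_reflect[OF assms(1), of x] soft_pos_reflect[OF assms(1), of y]
    soft_pos_mono[of k "- y - k" "- x - k"] assms by simp

lemma soft_pos_bounds:
  assumes "k > 0"
  shows "max 0 z \<le> soft_pos k z" "soft_pos k z \<le> \<bar>z\<bar> + k"
proof -
  have 0: "soft_pos k y \<ge> 0" for y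
    using assms by (auto simp: soft_pos_def intro!: divide_nonneg_pos power_mono)
  then show "max 0 z \<le> soft_pos k z"
    using soft_pos_reflect[OF assms, of z] 0[of "- z - k"] 0[of z] assms by auto
  have "soft_pos k 0 = k / 2" using assms by (simp add: soft_pos_def power2_eq_square)
  then show "soft_pos k z \<le> \<bar>z\<bar> + k"
    using soft_pos_mono[OF assms, of z "\<bar>z\<bar>"] soft_pos_increment_le[OF assms, of 0 "\<bar>z\<bar>"] assms
      abs_ge_self[of z] abs_ge_zero[of z] by linarith
qed

lemma soft_step_bounds:
  assumes "k > 0"
  shows "0 \<le> soft_step k z" "soft_step k z \<le> 1"
    "z \<ge> 0 \<Longrightarrow> soft_step k z = 1" "z \<le> - k \<Longrightarrow> soft_step k z = 0"
  using assms by (auto simp: soft_step_def field_simps max_def)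

text \<open>The slope is 1 for \<open>z \<ge> 0\<close> and \<open>- e\<close> for
  \<open>z \<le> - k\<close>, so the function grows in both directions and controls
  \<open>\<bar>z\<bar>\<close>. The derivative is \<open>tilted_step\<close>.\<close>

definition tilted_pos :: "real \<Rightarrow> real \<Rightarrow> real \<Rightarrow> real" where
  "tilted_pos e k z = (1 + e) * soft_pos k z - e * z"

definition tilted_step :: "real \<Rightarrow> real \<Rightarrow> real \<Rightarrow> real" where
  "tilted_step e k z = (1 + e) * soft_step k z - e"

lemma tilted_pos_bounds:
  assumes "k > 0" "0 < e" "e \<le> 1"
  shows "e * \<bar>z\<bar> \<le> tilted_pos e k z" "tilted_pos e k z \<le> 3 * \<bar>z\<bar> + 2 * k"
proof -
  note b = soft_pos_bounds[OF assms(1), of z]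
  have "(1 + e) * max 0 z \<le> (1 + e) * soft_pos k z"
    using b assms by (intro mult_left_mono) auto
  moreover have "e * z \<le> z" if "z \<ge> 0" using that assms by (simp add: mult_left_le_one_le)
  ultimately show "e * \<bar>z\<bar> \<le> tilted_pos e k z"
    by (cases "z \<ge> 0") (auto simp: tilted_pos_def algebra_simps)
  have "(1 + e) * soft_pos k z \<le> 2 * (\<bar>z\<bar> + k)"
    using b assms by (intro mult_mono) auto
  moreover have "- (e * z) \<le> \<bar>z\<bar>"
  proof -
    have "e * (- z) \<le> e * \<bar>z\<bar>" using assms by (intro mult_left_mono) auto
    then have "- (e * z) \<le> e * \<bar>z\<bar>" by simp
    also have "\<dots> \<le> \<bar>z\<bar>" using assms by (simp add: mult_left_le_one_le)
    finally show ?thesis .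
  qed
  ultimately show "tilted_pos e k z \<le> 3 * \<bar>z\<bar> + 2 * k"
    by (simp add: tilted_pos_def algebra_simps)
qed

text \<open>Since \<open>e \<le> 1\<close>, tilting at most doubles the second-order term of
  \<open>soft_pos\<close>, and slopes in \<open>[- e, 1]\<close> make the function
  1-Lipschitz.\<close>

lemma tilted_pos_increment:
  assumes "k > 0" "0 < e" "e \<le> 1"
  shows "tilted_pos e k (z + h) - tilted_pos e k z \<le> tilted_step e k z * h + h\<^sup>2 / k"
    and "\<bar>tilted_pos e k (z + h) - tilted_pos e k z\<bar> \<le> \<bar>h\<bar>"
proof -
  have "(1 + e) * (soft_pos k (z + h) - soft_pos k z) \<le> (1 + e) * (soft_step k z * h + h\<^sup>2 / (2 * k))"
    using assms soft_pos_taylor[of k z h] by (intro mult_left_mono) auto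
  moreover have "(1 + e) * (h\<^sup>2 / (2 * k)) \<le> 2 * (h\<^sup>2 / (2 * k))"
    using assms by (intro mult_right_mono) auto
  ultimately show "tilted_pos e k (z + h) - tilted_pos e k z \<le> tilted_step e k z * h + h\<^sup>2 / k"
    by (simp add: tilted_pos_def tilted_step_def algebra_simps)
  have key: "tilted_pos e k y - tilted_pos e k x \<in> {-(y - x)..y - x}" if "x \<le> y" for x y
  proof -
    have D: "0 \<le> soft_pos k y - soft_pos k x" "soft_pos k y - soft_pos k x \<le> y - x"
      using soft_pos_mono[OF assms(1) that] soft_pos_increment_le[OF assms(1) that] by auto
    have "(1 + e) * (soft_pos k y - soft_pos k x) \<le> (1 + e) * (y - x)" "0 \<le> (1 + e) * (soft_pos k y - soft_pos k x)"
      using D assms by (auto intro!: mult_left_mono mult_nonneg_nonneg)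
    moreover have "e * (y - x) \<le> y - x"
      using that assms by (simp add: mult_left_le_one_le)
    ultimately show ?thesis by (simp add: tilted_pos_def algebra_simps)
  qed
  show "\<bar>tilted_pos e k (z + h) - tilted_pos e k z\<bar> \<le> \<bar>h\<bar>"
    using key[of z "z + h"] key[of "z + h" z] by (cases "h \<ge> 0") auto
qed

text \<open>The last claim is the mean reversion of a class without queue. The constant
  \<open>2 * k\<close> absorbs the zone between \<open>- k\<close> and 0, where the slope may have
  the wrong sign.\<close>

lemma tilted_step_bounds:
  assumes "k > 0" "0 < e" "e \<le> 1"
  shows "- e \<le> tilted_step e k z" "tilted_step e k z \<le> 1"
    "z \<ge> 0 \<Longrightarrow> tilted_step e k z = 1"
    "- (tilted_step e k z * z) \<le> 2 * k - e * \<bar>z\<bar>"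
proof -
  note b = soft_step_bounds[OF assms(1), of z]
  have "(1 + e) * soft_step k z \<le> (1 + e) * 1"
    using b assms by (intro mult_left_mono) auto
  then show le1: "tilted_step e k z \<le> 1" by (simp add: tilted_step_def)
  show ge: "- e \<le> tilted_step e k z" using b assms by (simp add: tilted_step_def)
  show pos: "tilted_step e k z = 1" if "z \<ge> 0" using b(3)[OF that] by (simp add: tilted_step_def)
  show "- (tilted_step e k z * z) \<le> 2 * k - e * \<bar>z\<bar>"
  proof -
    consider "z \<ge> 0" | "z < 0" "- k < z" | "z \<le> - k" by linarith
    then show ?thesis
    proof cases
      case 1
      then have "e * z \<le> z" using assms by (simp add: mult_left_le_one_le)
      then show ?thesis using 1 pos assms by simp
    next
      case 2
      have "tilted_step e k z * (- z) \<le> 1 * (- z)" using le1 2 by (intro mult_right_mono) auto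
      moreover have "e * (- z) \<le> 1 * (- z)" using assms 2 by (intro mult_right_mono) auto
      moreover have "\<bar>z\<bar> = - z" using 2 by simp
      ultimately show ?thesis using 2 by (simp only: mult_minus_right)
    next
      case 3
      then show ?thesis using b(4) assms by (simp add: tilted_step_def)
    qed
  qed
qed

text \<open>
  The witness \<open>b\<close> is the first-order drift contribution of one class. The decreasing branch of
  \<open>tilted_pos\<close> is flat enough (\<open>e * nu \<le> mu\<close>) for abandonments not to spoil the bound: a long
  queue at \<open>z < 0\<close> forces a service deficit that other classes receive as extra service.
\<close>

lemma class_drift:
  fixes lam mu nu e k \<theta> d r P Z B z :: real
  defines "w \<equiv> \<lambda>y. tilted_pos e k y / mu"
  assumes par: "lam > 0" "mu > 0" "nu \<ge> 0" and e: "0 < e" "e \<le> 1" "e * nu \<le> mu"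
    and k: "k \<ge> 1" and \<theta>: "0 < \<theta>" "\<theta> \<le> mu" and d: "0 < d" "d \<le> 1" and r: "r * d\<^sup>2 = 1"
    and P: "0 \<le> P" "P \<le> Z" "P \<le> B * r" and z: "z = (Z - lam / mu * r) * d"
  shows "\<exists>b. b \<le> - ((P - lam / mu * r) * d) \<and> (P = Z \<longrightarrow> b \<le> 2 * k - e * \<bar>z\<bar>) \<and>
    lam * r * (exp (\<theta> * (w (z + d) - w z)) - 1) +
      (mu * P + nu * (Z - P)) * (exp (\<theta> * (w (z - d) - w z)) - 1)
    \<le> \<theta> * (b + (1 / k + \<theta> / mu) * (lam / mu + B + lam / mu * (nu / mu)))"
proof -
  define s where "s = tilted_step e k z"
  \<comment> \<open>The second-order coefficient: \<open>1 / k\<close> from the curvature of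
    \<open>tilted_pos\<close>, \<open>\<theta> / mu\<close> from the quadratic remainder of the
    exponential.\<close>
  define c where "c = 1 / k + \<theta> / mu"
  define q where "q = (Z - P) * d"
  \<comment> \<open>First-order effect of abandonments, with sign reversed. For
    \<open>z \<ge> 0\<close> they only lower the potential and are discarded.\<close>
  define X where "X = (if z < 0 then nu / mu * s * q else 0)"
  define b where "b = - s * (P - lam / mu * r) * d - X"
  have k0: "k > 0" using k by simp
  note s = tilted_step_bounds[OF k0 e(1,2), of z, folded s_def]
  have c0: "c > 0" using k \<theta> par by (simp add: c_def add_pos_pos)
  have q0: "q \<ge> 0" using P d by (simp add: q_def)
  have r0: "r > 0" using r d by (metis zero_less_mult_pos2 zero_less_one zero_less_power)
  \<comment> \<open>The exponential is expanded by \<open>exp_le_quadratic\<close>, which applies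
    because \<open>\<theta> \<le> mu\<close> and \<open>d \<le> 1\<close> keep the exponent at most
    1. The second estimate is kept to determine the sign of \<open>dn\<close>.\<close>
  have jump: "exp (\<theta> * (w (z + h) - w z)) - 1 \<le> \<theta> / mu * (s * h + d\<^sup>2 * c)"
      "w (z + h) - w z \<le> (s * h + d\<^sup>2 / k) / mu" if h: "\<bar>h\<bar> = d" for h
  proof -
    define u where "u = tilted_pos e k (z + h) - tilted_pos e k z"
    have hd: "h\<^sup>2 = d\<^sup>2" using h by (metis power2_abs)
    have u: "u \<le> s * h + d\<^sup>2 / k" "\<bar>u\<bar> \<le> d"
      using tilted_pos_increment[OF k0 e(1,2), of z h] h hd by (auto simp: u_def s_def)
    have wu: "w (z + h) - w z = u / mu" by (simp add: w_def u_def diff_divide_distrib)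
    then show "w (z + h) - w z \<le> (s * h + d\<^sup>2 / k) / mu"
      using u par by (simp add: divide_right_mono)
    have tm: "0 < \<theta> / mu" "\<theta> / mu \<le> 1" using \<theta> par by auto
    have "\<theta> / mu * u \<le> 1 * \<bar>u\<bar>"
      using tm by (intro order_trans[OF mult_left_mono[OF abs_ge_self] mult_right_mono]) auto
    then have "\<theta> / mu * u \<le> 1" using u d by simp
    then have "exp (\<theta> / mu * u) - 1 \<le> \<theta> / mu * u + (\<theta> / mu * u)\<^sup>2"
      by (rule exp_le_quadratic)
    also have "(\<theta> / mu * u)\<^sup>2 \<le> (\<theta> / mu * d)\<^sup>2"
    proof -
      have "u\<^sup>2 \<le> d\<^sup>2" using u by (metis abs_ge_zero power2_abs power_mono)
      then show ?thesis unfolding power_mult_distrib by (intro mult_left_mono) auto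
    qed
    also have "\<theta> / mu * u \<le> \<theta> / mu * (s * h + d\<^sup>2 / k)"
      using u tm by (intro mult_left_mono) auto
    also have "\<theta> / mu * (s * h + d\<^sup>2 / k) + (\<theta> / mu * d)\<^sup>2 = \<theta> / mu * (s * h + d\<^sup>2 * c)"
      unfolding c_def divide_inverse by algebra
    finally show "exp (\<theta> * (w (z + h) - w z)) - 1 \<le> \<theta> / mu * (s * h + d\<^sup>2 * c)"
      by (simp add: wu)
  qed
  define up where "up = exp (\<theta> * (w (z + d) - w z)) - 1"
  define dn where "dn = exp (\<theta> * (w (z - d) - w z)) - 1"
  have upb: "up \<le> \<theta> / mu * (s * d + d\<^sup>2 * c)" using jump(1)[of d] d by (simp add: up_def)
  have dnb: "dn \<le> \<theta> / mu * (- s * d + d\<^sup>2 * c)" "w (z - d) - w z \<le> (- s * d + d\<^sup>2 / k) / mu"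
    using jump[of "- d"] d by (simp_all add: dn_def)
  have T1: "lam * r * up \<le> \<theta> * (s * (lam / mu * r) * d + c * (lam / mu))"
  proof -
    have "lam * r * up \<le> lam * r * (\<theta> / mu * (s * d + d\<^sup>2 * c))"
      using upb par r0 by (intro mult_left_mono) auto
    also have "\<dots> = \<theta> * (s * (lam / mu * r) * d + c * (lam / mu) * (r * d\<^sup>2))"
      using par by (simp add: field_simps)
    finally show ?thesis by (simp add: r)
  qed
  have T2: "mu * P * dn \<le> \<theta> * (- s * P * d + c * B)"
  proof -
    have "mu * P * dn \<le> mu * P * (\<theta> / mu * (- s * d + d\<^sup>2 * c))"
      using dnb par P by (intro mult_left_mono) auto
    also have "\<dots> = \<theta> * (- s * P * d + c * (P * d\<^sup>2))"
      using par by (simp add: field_simps)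
    also have "\<dots> \<le> \<theta> * (- s * P * d + c * (B * r * d\<^sup>2))"
      using \<theta> c0 P by (intro mult_left_mono add_left_mono mult_right_mono) auto
    also have "B * r * d\<^sup>2 = B" using r by (simp add: mult.assoc)
    finally show ?thesis .
  qed
  \<comment> \<open>For \<open>z \<ge> 0\<close> the slope is 1 and \<open>k \<ge> 1\<close>, so
    \<open>dn \<le> 0\<close>. For \<open>z < 0\<close> the queue is shorter than
    \<open>lam / mu * r\<close>, so the second-order term stays bounded although queues are
    unbounded in general.\<close>
  have T3: "nu * (Z - P) * dn \<le> \<theta> * (- X + c * (lam / mu * (nu / mu)))"
  proof (cases "z < 0")
    case False
    then have "s = 1" using s by simp
    have "d\<^sup>2 / k \<le> d * (d / k)" by (simp add: power2_eq_square)
    also have "\<dots> \<le> d * 1" using d k by (intro mult_left_mono) (auto simp: field_simps)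
    finally have "(- s * d + d\<^sup>2 / k) / mu \<le> 0"
      using par \<open>s = 1\<close> by (simp add: divide_nonpos_pos)
    then have "w (z - d) - w z \<le> 0" using dnb(2) by simp
    then have "\<theta> * (w (z - d) - w z) \<le> 0" using \<theta> by (simp add: mult_nonneg_nonpos)
    then have "dn \<le> 0" by (simp add: dn_def)
    then have "nu * (Z - P) * dn \<le> 0"
      using par P by (intro mult_nonneg_nonpos) auto
    also have "0 \<le> \<theta> * (c * (lam / mu * (nu / mu)))" using \<theta> c0 par by simp
    finally show ?thesis using False by (simp add: X_def)
  next
    case True
    then have "Z - lam / mu * r < 0" using z d by (simp add: mult_less_0_iff)
    then have "(Z - P) * d\<^sup>2 \<le> lam / mu * r * d\<^sup>2" using P by (intro mult_right_mono) auto
    also have "\<dots> = lam / mu * (r * d\<^sup>2)" by (simp only: mult.assoc)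
    finally have Q: "(Z - P) * d\<^sup>2 \<le> lam / mu" by (simp only: r mult_1_right)
    have "nu * (Z - P) * dn \<le> nu * (Z - P) * (\<theta> / mu * (- s * d + d\<^sup>2 * c))"
      using dnb par P by (intro mult_left_mono) auto
    also have "\<dots> = \<theta> * (- (nu / mu * s * q) + c * (((Z - P) * d\<^sup>2) * (nu / mu)))"
      unfolding q_def divide_inverse by algebra
    also have "\<dots> \<le> \<theta> * (- (nu / mu * s * q) + c * (lam / mu * (nu / mu)))"
      using \<theta> c0 par Q by (intro mult_left_mono add_left_mono mult_right_mono) auto
    finally show ?thesis using True by (simp add: X_def)
  qed
  have "lam * r * up + (mu * P + nu * (Z - P)) * dn = lam * r * up + mu * P * dn + nu * (Z - P) * dn"
    by (simp add: algebra_simps)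
  also have "\<dots> \<le> \<theta> * (s * (lam / mu * r) * d + c * (lam / mu)) + \<theta> * (- s * P * d + c * B)
      + \<theta> * (- X + c * (lam / mu * (nu / mu)))"
    using T1 T2 T3 by (intro add_mono)
  also have "\<dots> = \<theta> * (b + c * (lam / mu + B + lam / mu * (nu / mu)))"
    unfolding b_def divide_inverse by algebra
  finally have drift: "lam * r * up + (mu * P + nu * (Z - P)) * dn
      \<le> \<theta> * (b + c * (lam / mu + B + lam / mu * (nu / mu)))" .
  have psi: "(P - lam / mu * r) * d = z - q" by (simp add: z q_def algebra_simps)
  have bz: "b = - s * (z - q) - X" by (simp only: b_def psi[symmetric] mult.assoc)
  have b1: "b \<le> - ((P - lam / mu * r) * d)"
  proof (cases "z < 0")
    case False
    then show ?thesis using s(3) unfolding psi bz X_def by simp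
  next
    case True
    define g where "g = nu / mu"
    have g: "g \<ge> 0" "g * e \<le> 1" using par e by (simp_all add: g_def field_simps)
    \<comment> \<open>This is the coefficient of the queue \<open>q\<close> in the loss. A negative
      slope satisfies \<open>s \<ge> - e\<close>, and \<open>g * e \<le> 1\<close> then prevents
      abandonments from outweighing the service deficit.\<close>
    have "0 \<le> (1 - s) + g * s"
    proof (cases "s \<ge> 0")
      case True
      then have "g * s \<ge> 0" using g by simp
      then show ?thesis using s(2) by linarith
    next
      case False
      have "g * (- s) \<le> g * e" using s(1) g by (intro mult_left_mono) auto
      then show ?thesis using False g by simp
    qed
    then have "0 \<le> ((1 - s) + g * s) * q" using q0 by simp
    moreover have "(1 - s) * z \<le> 0" using True s(2) by (intro mult_nonneg_nonpos) auto
    moreover have "b = - ((P - lam / mu * r) * d) + (1 - s) * z - ((1 - s) + g * s) * q"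
      using True unfolding psi bz X_def g_def[symmetric] by (simp add: algebra_simps)
    ultimately show ?thesis by linarith
  qed
  have b2: "b \<le> 2 * k - e * \<bar>z\<bar>" if "P = Z"
  proof -
    have "q = 0" using that by (simp add: q_def)
    then have "b = - (s * z)" by (simp add: bz X_def)
    then show ?thesis using s(4) by simp
  qed
  show ?thesis using drift b1 b2 unfolding c_def up_def dn_def by blast
qed

section \<open>Exponential moments\<close>

text \<open>A jump changes one coordinate, hence one summand of the exponent, so the exponential
  factors out of the generator and the drift becomes a sum of one-dimensional terms.\<close>

lemma service_system_exp_bound:
  fixes lam mu nu :: "'i::finite \<Rightarrow> real" and g :: "'i \<Rightarrow> real \<Rightarrow> real" and f :: "'s \<Rightarrow> ('i \<Rightarrow> nat) \<times> ('i \<Rightarrow> nat)"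
  assumes ss: "service_system a lam mu nu r S q f"
    and stat: "stationary_distribution S q p" and cK: "c > 0" "K \<ge> 0"
    and drift: "\<And>(Z :: 'i \<Rightarrow> nat) P z. (\<And>i. P i \<le> Z i) \<Longrightarrow> (\<Sum>i\<in>UNIV. P i) = min (num_servers a r) (\<Sum>i\<in>UNIV. Z i) \<Longrightarrow>
      z = (\<lambda>i. (real (Z i) - lam i / mu i * real r) * (1 / sqrt (real r))) \<Longrightarrow>
      exp (\<Sum>i\<in>UNIV. g i (z i)) *
      (\<Sum>l\<in>UNIV. lam l * real r * (exp (g l (z l + 1 / sqrt (real r)) - g l (z l)) - 1) +
        (mu l * real (P l) + nu l * (real (Z l) - real (P l))) * (exp (g l (z l - 1 / sqrt (real r)) - g l (z l)) - 1))
      \<le> c * K - c * exp (\<Sum>i\<in>UNIV. g i (z i))"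
  shows "(\<integral>\<^sup>+x. ennreal (exp (\<Sum>i\<in>UNIV. g i (Zhat lam mu r f x i))) \<partial>measure_pmf p) \<le> ennreal K"
proof -
  define d where "d = 1 / sqrt (real r)"
  define zeta where "zeta Z i = (real (Z i) - lam i / mu i * real r) * d" for Z :: "'i \<Rightarrow> nat" and i
  define G where "G Z = exp (\<Sum>i\<in>UNIV. g i (zeta Z i))" for Z
  have shift: "G (Z(l := n)) - G Z = G Z * (exp (g l (zeta Z l + (real n - real (Z l)) * d) - g l (zeta Z l)) - 1)"
    for Z l n
  proof -
    have "(\<Sum>i\<in>UNIV. g i (zeta (Z(l := n)) i)) = (\<Sum>i\<in>UNIV. g i (zeta Z i)) +
       (\<Sum>i\<in>UNIV. if i = l then g l (zeta (Z(l := n)) l) - g l (zeta Z l) else 0)"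
      unfolding sum.distrib[symmetric] by (intro sum.cong) (auto simp: zeta_def)
    also have "\<dots> = (\<Sum>i\<in>UNIV. g i (zeta Z i)) + (g l (zeta (Z(l := n)) l) - g l (zeta Z l))"
      by simp
    also have "zeta (Z(l := n)) l = zeta Z l + (real n - real (Z l)) * d"
      by (simp add: zeta_def algebra_simps)
    finally show ?thesis by (simp only: G_def exp_add right_diff_distrib mult_1_right)
  qed
  have "(\<integral>\<^sup>+x. ennreal (G (fst (f x))) \<partial>measure_pmf p) \<le> ennreal K"
  proof (rule service_system_drift_bound[OF ss stat _ cK])
    show "G z \<ge> 0" for z by (simp add: G_def)
    fix x Z P assume x: "x \<in> S" "Z = fst (f x)" "P = snd (f x)"
    have PZ: "P i \<le> Z i" for i using ss x by (simp add: service_system_def)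
    have sum: "(\<Sum>i\<in>UNIV. P i) = min (num_servers a r) (\<Sum>i\<in>UNIV. Z i)"
      using ss x by (simp add: service_system_def)
    have "(\<Sum>l\<in>UNIV. lam l * real r * (G (Z(l := Z l + 1)) - G Z) +
       (mu l * real (P l) + nu l * (real (Z l) - real (P l))) * (G (Z(l := Z l - 1)) - G Z)) =
      (\<Sum>l\<in>UNIV. G Z * (lam l * real r * (exp (g l (zeta Z l + d) - g l (zeta Z l)) - 1) +
        (mu l * real (P l) + nu l * (real (Z l) - real (P l))) * (exp (g l (zeta Z l - d) - g l (zeta Z l)) - 1)))"
    proof (intro sum.cong refl)
      fix l
      \<comment> \<open>At \<open>Z l = 0\<close> the shift by \<open>- d\<close> is not the one
        produced by truncated subtraction, but the departure rate is 0 there and both sides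
        vanish.\<close>
      have down: "(mu l * real (P l) + nu l * (real (Z l) - real (P l))) * (G (Z(l := Z l - 1)) - G Z) =
         G Z * ((mu l * real (P l) + nu l * (real (Z l) - real (P l))) * (exp (g l (zeta Z l - d) - g l (zeta Z l)) - 1))"
      proof (cases "Z l = 0")
        case True
        then show ?thesis using PZ[of l] by simp
      next
        case False
        then have "(real (Z l - 1) - real (Z l)) * d = - d" by simp
        then show ?thesis unfolding shift by simp
      qed
      have up: "G (Z(l := Z l + 1)) - G Z = G Z * (exp (g l (zeta Z l + d) - g l (zeta Z l)) - 1)"
        unfolding shift by simp
      show "lam l * real r * (G (Z(l := Z l + 1)) - G Z) +
       (mu l * real (P l) + nu l * (real (Z l) - real (P l))) * (G (Z(l := Z l - 1)) - G Z) =
       G Z * (lam l * real r * (exp (g l (zeta Z l + d) - g l (zeta Z l)) - 1) +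
        (mu l * real (P l) + nu l * (real (Z l) - real (P l))) * (exp (g l (zeta Z l - d) - g l (zeta Z l)) - 1))"
        unfolding down up by (simp only: distrib_left mult.left_commute)
    qed
    also have "\<dots> \<le> c * K - c * G Z"
      unfolding sum_distrib_left[symmetric] G_def
      using drift[OF PZ sum, of "zeta Z"] by (simp add: zeta_def[abs_def] d_def)
    finally show "(\<Sum>l\<in>UNIV. lam l * real r * (G (Z(l := Z l + 1)) - G Z) +
       (mu l * real (P l) + nu l * (real (Z l) - real (P l))) * (G (Z(l := Z l - 1)) - G Z)) \<le> c * K - c * G Z" .
  qed
  moreover have "zeta (fst (f x)) i = Zhat lam mu r f x i" for x i
    by (simp add: zeta_def Zhat_def d_def)
  ultimately show ?thesis by (simp add: G_def)
qed

section \<open>Lower tails when abandonment is no faster than service\<close>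

text \<open>The potential involves class \<open>i\<close> alone. From
  \<open>nu i \<le> mu i\<close>, its departure rate is at most \<open>mu i * Z i\<close> however
  the servers are allocated. One \<open>K\<close> serves all \<open>r\<close> and all
  policies.\<close>

lemma neg_exp_moment_bound:
  fixes lam mu nu :: "'i::finite \<Rightarrow> real"
  assumes par: "\<And>i. lam i > 0" "\<And>i. mu i > 0" "\<And>i. nu i \<ge> 0" "\<And>i. nu i \<le> mu i" and "\<theta> > 0"
  shows "\<exists>K\<ge>0. \<forall>r S q (f :: 's \<Rightarrow> _) p. r \<ge> 1 \<longrightarrow> service_system a lam mu nu r S q f \<longrightarrow>
    stationary_distribution S q p \<longrightarrow>
    (\<integral>\<^sup>+x. ennreal (exp (- \<theta> * Zhat lam mu r f x i)) \<partial>measure_pmf p) \<le> ennreal K"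
proof -
  obtain K where K: "K > 0" "\<And>d r Z D z. 0 < d \<Longrightarrow> d \<le> 1 \<Longrightarrow> r * d\<^sup>2 = 1 \<Longrightarrow> D \<le> mu i * Z \<Longrightarrow> z = (Z - lam i / mu i * r) * d \<Longrightarrow>
    exp (- \<theta> * z) * (lam i * r * (exp (- \<theta> * d) - 1) + D * (exp (\<theta> * d) - 1)) \<le> K - exp (- \<theta> * z)"
    using down_drift_exp[OF par(1)[of i] par(2)[of i] \<open>\<theta> > 0\<close>] by blast
  define g where "g j z = (if j = i then - \<theta> * z else 0)" for j :: 'i and z :: real
  have gs: "(\<Sum>j\<in>UNIV. g j (z j)) = - \<theta> * z i" for z by (simp add: g_def)
  have "(\<integral>\<^sup>+x. ennreal (exp (- \<theta> * Zhat lam mu r f x i)) \<partial>measure_pmf p) \<le> ennreal K"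
    if r: "r \<ge> 1" and ss: "service_system a lam mu nu r S q f" and stat: "stationary_distribution S q p"
    for r S q p and f :: "'s \<Rightarrow> ('i \<Rightarrow> nat) \<times> ('i \<Rightarrow> nat)"
  proof -
    define d where "d = 1 / sqrt (real r)"
    have d: "0 < d" "d \<le> 1" "real r * d\<^sup>2 = 1" using r by (auto simp: d_def power_divide)
    have "(\<integral>\<^sup>+x. ennreal (exp (\<Sum>j\<in>UNIV. g j (Zhat lam mu r f x j))) \<partial>measure_pmf p) \<le> ennreal K"
    proof (rule service_system_exp_bound[OF ss stat zero_less_one])
      show "0 \<le> K" using K by simp
      fix Z P :: "'i \<Rightarrow> nat" and z :: "'i \<Rightarrow> real"
      assume PZ: "\<And>i. P i \<le> Z i" and z: "z = (\<lambda>i. (real (Z i) - lam i / mu i * real r) * (1 / sqrt (real r)))"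
      define D where "D = mu i * real (P i) + nu i * (real (Z i) - real (P i))"
      have "nu i * (real (Z i) - real (P i)) \<le> mu i * (real (Z i) - real (P i))"
        using PZ[of i] par by (intro mult_right_mono) auto
      then have D: "D \<le> mu i * real (Z i)" by (simp add: D_def algebra_simps)
      have inc: "g l (z l + h) - g l (z l) = (if l = i then - \<theta> * h else 0)"
         "g l (z l - h) - g l (z l) = (if l = i then \<theta> * h else 0)" for l h
        by (auto simp: g_def algebra_simps)
      have "(\<Sum>l\<in>UNIV. lam l * real r * (exp (g l (z l + d) - g l (z l)) - 1) +
          (mu l * real (P l) + nu l * (real (Z l) - real (P l))) * (exp (g l (z l - d) - g l (z l)) - 1))
        = (\<Sum>l\<in>UNIV. if l = i then lam i * real r * (exp (- \<theta> * d) - 1) + D * (exp (\<theta> * d) - 1) else 0)"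
        unfolding inc by (intro sum.cong) (auto simp: D_def)
      also have "\<dots> = lam i * real r * (exp (- \<theta> * d) - 1) + D * (exp (\<theta> * d) - 1)" by simp
      finally show "exp (\<Sum>i\<in>UNIV. g i (z i)) *
        (\<Sum>l\<in>UNIV. lam l * real r * (exp (g l (z l + 1 / sqrt (real r)) - g l (z l)) - 1) +
          (mu l * real (P l) + nu l * (real (Z l) - real (P l))) * (exp (g l (z l - 1 / sqrt (real r)) - g l (z l)) - 1))
        \<le> 1 * K - 1 * exp (\<Sum>i\<in>UNIV. g i (z i))"
        using K(2)[OF d D, of "z i"] unfolding gs d_def[symmetric] by (simp add: z d_def)
    qed
    then show ?thesis by (simp only: gs)
  qed
  then show ?thesis using K(1) by (intro exI[of _ K]) auto
qed

text \<open>The sum is at most the number of terms times the largest. Joint moments thus follow from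
  marginal ones without independence; the larger exponent is harmless when every exponent is
  available.\<close>

lemma exp_sum_le_sum_exp:
  fixes x :: "'i::finite \<Rightarrow> real"
  assumes "\<And>i. x i \<ge> 0"
  shows "exp (\<Sum>i\<in>UNIV. x i) \<le> (\<Sum>i\<in>UNIV. exp (real CARD('i) * x i))"
proof -
  obtain j where j: "\<And>i. x i \<le> x j"
    using Max_in[of "range x"] Max_ge[of "range x"] by (metis finite_imageI finite rangeE rangeI empty_not_UNIV image_is_empty)
  have "(\<Sum>i\<in>UNIV. x i) \<le> (\<Sum>i\<in>(UNIV::'i set). x j)" using j by (intro sum_mono)
  then have "exp (\<Sum>i\<in>UNIV. x i) \<le> exp (real CARD('i) * x j)" by simp
  also have "\<dots> \<le> (\<Sum>i\<in>UNIV. exp (real CARD('i) * x i))"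
    by (rule member_le_sum) auto
  finally show ?thesis .
qed

lemma neg_part_exp_moment_bound:
  fixes lam mu nu :: "'i::finite \<Rightarrow> real"
  assumes par: "\<And>i. lam i > 0" "\<And>i. mu i > 0" "\<And>i. nu i \<ge> 0" "\<And>i. nu i \<le> mu i" and \<theta>: "\<theta> > 0"
  shows "\<exists>K\<ge>0. \<forall>r S q (f :: 's \<Rightarrow> _) p. r \<ge> 1 \<longrightarrow> service_system a lam mu nu r S q f \<longrightarrow>
    stationary_distribution S q p \<longrightarrow>
    (\<integral>\<^sup>+x. ennreal (exp (\<theta> * (\<Sum>i\<in>UNIV. neg_part (Zhat lam mu r f x i)))) \<partial>measure_pmf p) \<le> ennreal K"
proof -
  define t where "t = real CARD('i) * \<theta>"
  have t: "t > 0" using \<theta> by (simp add: t_def)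
  define bd where "bd i K \<longleftrightarrow> K \<ge> 0 \<and> (\<forall>r S q (f :: 's \<Rightarrow> _) p. r \<ge> 1 \<longrightarrow> service_system a lam mu nu r S q f \<longrightarrow>
    stationary_distribution S q p \<longrightarrow>
    (\<integral>\<^sup>+x. ennreal (exp (- t * Zhat lam mu r f x i)) \<partial>measure_pmf p) \<le> ennreal K)" for i K
  have "\<forall>i. \<exists>K. bd i K"
    unfolding bd_def by (intro allI neg_exp_moment_bound[where 's='s and a=a, OF par t])
  then obtain K where "\<And>i. bd i (K i)" by metis
  then have K: "\<And>i. K i \<ge> 0"
    "\<And>i r S q (f :: 's \<Rightarrow> _) p. r \<ge> 1 \<Longrightarrow> service_system a lam mu nu r S q f \<Longrightarrow>
    stationary_distribution S q p \<Longrightarrow>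
    (\<integral>\<^sup>+x. ennreal (exp (- t * Zhat lam mu r f x i)) \<partial>measure_pmf p) \<le> ennreal (K i)"
    unfolding bd_def by blast+
  have "(\<integral>\<^sup>+x. ennreal (exp (\<theta> * (\<Sum>i\<in>UNIV. neg_part (Zhat lam mu r f x i)))) \<partial>measure_pmf p)
      \<le> ennreal (\<Sum>i\<in>UNIV. 1 + K i)"
    if r: "r \<ge> 1" "service_system a lam mu nu r S q f" "stationary_distribution S q p"
    for r S q p and f :: "'s \<Rightarrow> ('i \<Rightarrow> nat) \<times> ('i \<Rightarrow> nat)"
  proof -
    have "exp (\<theta> * (\<Sum>i\<in>UNIV. neg_part (z i))) \<le> (\<Sum>i\<in>UNIV. 1 + exp (- t * z i))" for z :: "'i \<Rightarrow> real"
    proof -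
      have "exp (\<theta> * (\<Sum>i\<in>UNIV. neg_part (z i))) \<le> (\<Sum>i\<in>UNIV. exp (real CARD('i) * (\<theta> * neg_part (z i))))"
        unfolding sum_distrib_left using \<theta> by (intro exp_sum_le_sum_exp) (simp add: neg_part_def min_def mult_nonneg_nonpos)
      \<comment> \<open>The summand 1 covers \<open>z i \<ge> 0\<close>, where
        \<open>neg_part\<close> is 0.\<close>
      also have "\<dots> \<le> (\<Sum>i\<in>UNIV. 1 + exp (- t * z i))"
        using t by (intro sum_mono) (auto simp: neg_part_def t_def min_def mult.assoc add_increasing)
      finally show ?thesis .
    qed
    then have "(\<integral>\<^sup>+x. ennreal (exp (\<theta> * (\<Sum>i\<in>UNIV. neg_part (Zhat lam mu r f x i)))) \<partial>measure_pmf p)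
      \<le> (\<integral>\<^sup>+x. (\<Sum>i\<in>UNIV. 1 + ennreal (exp (- t * Zhat lam mu r f x i))) \<partial>measure_pmf p)"
      by (intro nn_integral_mono) (simp flip: ennreal_1 ennreal_plus add: sum_ennreal ennreal_leI)
    also have "\<dots> = (\<Sum>i\<in>UNIV. 1 + (\<integral>\<^sup>+x. ennreal (exp (- t * Zhat lam mu r f x i)) \<partial>measure_pmf p))"
      by (simp add: nn_integral_sum nn_integral_add)
    also have "\<dots> \<le> (\<Sum>i\<in>UNIV. 1 + ennreal (K i))"
      using K(2)[OF r] by (intro sum_mono add_left_mono)
    also have "\<dots> = ennreal (\<Sum>i\<in>UNIV. 1 + K i)"
      using K(1) by (simp flip: ennreal_1 ennreal_plus add: sum_ennreal add_nonneg_nonneg)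
    finally show ?thesis .
  qed
  moreover have "(\<Sum>i\<in>UNIV. 1 + K i) \<ge> 0" using K(1) by (intro sum_nonneg) (simp add: add_nonneg_nonneg)
  ultimately show ?thesis by blast
qed

section \<open>Joint two-sided exponential bound\<close>

text \<open>The lower bound provides the spare capacity that drives the system down when all servers
  are busy; the upper bound provides the constant \<open>B = a + 2\<close> for
  \<open>class_drift\<close>.\<close>

lemma num_servers_bounds:
  assumes "a > 0" "r \<ge> 1"
  shows "real r + a * sqrt (real r) \<le> real (num_servers a r)"
    "real (num_servers a r) \<le> (a + 2) * real r"
proof -
  have s: "1 \<le> sqrt (real r)" using assms by simp
  then have "sqrt (real r) * 1 \<le> sqrt (real r) * sqrt (real r)" by (intro mult_left_mono) auto
  then have sr: "sqrt (real r) \<le> real r" by simp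
  have nn: "real r + a * sqrt (real r) \<ge> 0" using assms by simp
  have N: "real (num_servers a r) = of_int \<lceil>real r + a * sqrt (real r)\<rceil>"
    unfolding num_servers_def using nn by (intro of_nat_nat) (simp add: ceiling_mono[of 0, simplified])
  show "real r + a * sqrt (real r) \<le> real (num_servers a r)" unfolding N by simp
  have "real (num_servers a r) \<le> real r + a * sqrt (real r) + 1" unfolding N by linarith
  also have "\<dots> \<le> real r + a * real r + real r"
    using assms sr by (intro add_mono mult_left_mono) auto
  finally show "real (num_servers a r) \<le> (a + 2) * real r" by (simp add: algebra_simps)
qed

text \<open>One bound on the absolute values yields both one-sided estimates for small exponents and
  tightness.\<close>

lemma abs_exp_moment_bound:
  fixes lam mu nu :: "'i::finite \<Rightarrow> real"
  assumes a: "a > 0"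
    and par: "\<And>i. lam i > 0" "\<And>i. mu i > 0" "\<And>i. nu i \<ge> 0" and crit: "(\<Sum>i\<in>UNIV. lam i / mu i) = 1"
  shows "\<exists>\<eta>>0. \<exists>K\<ge>0. \<forall>r S q (f :: 's \<Rightarrow> _) p. r \<ge> 1 \<longrightarrow> service_system a lam mu nu r S q f \<longrightarrow>
    stationary_distribution S q p \<longrightarrow>
    (\<integral>\<^sup>+x. ennreal (exp (\<eta> * (\<Sum>i\<in>UNIV. \<bar>Zhat lam mu r f x i\<bar>))) \<partial>measure_pmf p) \<le> ennreal K"
proof -
  \<comment> \<open>The second-order factor of \<open>class_drift\<close> with
    \<open>B = a + 2\<close>.\<close>
  define C where "C i = lam i / mu i + (a + 2) + lam i / mu i * (nu i / mu i)" for i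
  define Ct where "Ct = (\<Sum>i\<in>UNIV. C i)"
  define m where "m = Min (range mu)"
  define M where "M = (\<Sum>i\<in>UNIV. mu i)"
  \<comment> \<open>The choices of \<open>k\<close> and \<open>\<theta>\<close> make
    \<open>1 / k\<close> and each \<open>\<theta> / mu i\<close> at most
    \<open>a / (4 * Ct)\<close>, so second-order terms use up at most half of the drift
    \<open>- a\<close>.\<close>
  define k where "k = 1 + 4 * Ct / a"
  \<comment> \<open>Small enough that \<open>e * nu i \<le> mu i\<close> for all classes at
    once.\<close>
  define e where "e = 1 / (1 + (\<Sum>i\<in>UNIV. nu i / mu i))"
  have C: "C i > 0" for i using par a by (simp add: C_def add_pos_nonneg add_pos_pos less_imp_le)
  have Ct: "Ct > 0" unfolding Ct_def using C by (intro sum_pos) auto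
  have m: "m > 0" "m \<le> mu i" for i using par by (auto simp: m_def)
  have M: "M > 0" unfolding M_def using par by (intro sum_pos) auto
  have muM: "mu i \<le> M" for i
    unfolding M_def using par by (intro member_le_sum) (auto simp: less_imp_le)
  define \<theta> where "\<theta> = min m (a * m / (4 * Ct))"
  have \<theta>: "\<theta> > 0" "\<theta> \<le> mu i" for i
    using m a Ct by (auto simp: \<theta>_def intro: order_trans[OF min.cobounded1])
  have k: "k \<ge> 1" "1 / k \<le> a / (4 * Ct)"
    using a Ct by (auto simp: k_def field_simps)
  have e: "0 < e" "e \<le> 1" "e * nu i \<le> mu i" for i
  proof -
    have sn: "0 \<le> (\<Sum>i\<in>UNIV. nu i / mu i)" using par by (intro sum_nonneg divide_nonneg_pos) auto
    then show e01: "0 < e" "e \<le> 1" by (auto simp: e_def)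
    have "nu i / mu i \<le> (\<Sum>i\<in>UNIV. nu i / mu i)"
      using par by (intro member_le_sum) (auto simp: less_imp_le)
    then have "nu i / mu i \<le> 1 + (\<Sum>i\<in>UNIV. nu i / mu i)" by simp
    then have "e * (nu i / mu i) \<le> e * (1 + (\<Sum>i\<in>UNIV. nu i / mu i))"
      using e01 by (intro mult_left_mono) auto
    also have "\<dots> = 1" using sn by (simp add: e_def)
    finally have "e * (nu i / mu i) \<le> 1" .
    then show "e * nu i \<le> mu i" using par(2)[of i] by (simp add: field_simps)
  qed
  have second: "(\<Sum>i\<in>UNIV. (1 / k + \<theta> / mu i) * C i) \<le> a / 2"
  proof -
    have "1 / k + \<theta> / mu i \<le> a / (2 * Ct)" for i
    proof -
      have "\<theta> / mu i \<le> (a * m / (4 * Ct)) / m"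
        using m(1) m(2)[of i] \<theta>(1) by (intro frac_le) (auto simp: \<theta>_def)
      then have "\<theta> / mu i \<le> a / (4 * Ct)" using m by simp
      then show ?thesis using k by simp
    qed
    then have "(\<Sum>i\<in>UNIV. (1 / k + \<theta> / mu i) * C i) \<le> (\<Sum>i\<in>UNIV. a / (2 * Ct) * C i)"
      using C by (intro sum_mono mult_right_mono) (auto simp: less_imp_le)
    also have "\<dots> = a / 2" using Ct unfolding sum_distrib_left[symmetric] Ct_def[symmetric] by simp
    finally show ?thesis .
  qed
  define w where "w i y = tilted_pos e k y / mu i" for i y
  \<comment> \<open>Without queues the first-order drift plus \<open>a\<close> is at most
    \<open>R - e * (\<Sum>i. \<bar>z i\<bar>)\<close>. If it is positive, the norm is below
    \<open>R / e\<close>, and \<open>W\<close> bounds the total potential there. \<open>K\<close> is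
    chosen so that \<open>c * K = \<theta> * R * exp (\<theta> * W)\<close>.\<close>
  define R where "R = 2 * real CARD('i) * k + a"
  define W where "W = (3 * (R / e) + 2 * real CARD('i) * k) / m"
  define c where "c = \<theta> * a / 2"
  define K where "K = \<theta> * R * exp (\<theta> * W) / c"
  have c: "c > 0" using \<theta> a by (simp add: c_def)
  have R: "R > 0" using k a by (simp add: R_def add_nonneg_pos)
  have K: "K \<ge> 0" using c R \<theta> by (simp add: K_def)
  have bound: "(\<integral>\<^sup>+x. ennreal (exp (\<Sum>i\<in>UNIV. \<theta> * w i (Zhat lam mu r f x i))) \<partial>measure_pmf p) \<le> ennreal K"
    if r: "r \<ge> 1" and ss: "service_system a lam mu nu r S q f" and stat: "stationary_distribution S q p"
    for r S q p and f :: "'s \<Rightarrow> ('i \<Rightarrow> nat) \<times> ('i \<Rightarrow> nat)"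
  proof (rule service_system_exp_bound[where g = "\<lambda>i y. \<theta> * w i y", OF ss stat c K])
    fix Z P :: "'i \<Rightarrow> nat" and z :: "'i \<Rightarrow> real"
    assume PZ: "\<And>i. P i \<le> Z i" and sum: "(\<Sum>i\<in>UNIV. P i) = min (num_servers a r) (\<Sum>i\<in>UNIV. Z i)"
      and z: "z = (\<lambda>i. (real (Z i) - lam i / mu i * real r) * (1 / sqrt (real r)))"
    define d where "d = 1 / sqrt (real r)"
    have d: "0 < d" "d \<le> 1" "real r * d\<^sup>2 = 1" using r by (auto simp: d_def power_divide)
    note N = num_servers_bounds[OF a r]
    have PB: "real (P i) \<le> (a + 2) * real r" for i
    proof -
      have "P i \<le> (\<Sum>i\<in>UNIV. P i)" by (intro member_le_sum) auto
      then have "P i \<le> num_servers a r" using sum by simp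
      then show ?thesis using N by linarith
    qed
    define T where "T l = lam l * real r * (exp (\<theta> * (w l (z l + d) - w l (z l))) - 1) +
        (mu l * real (P l) + nu l * (real (Z l) - real (P l))) * (exp (\<theta> * (w l (z l - d) - w l (z l))) - 1)" for l
    have "\<exists>b. b \<le> - ((real (P l) - lam l / mu l * real r) * d) \<and> (real (P l) = real (Z l) \<longrightarrow> b \<le> 2 * k - e * \<bar>z l\<bar>) \<and>
       T l \<le> \<theta> * (b + (1 / k + \<theta> / mu l) * C l)" for l
      unfolding T_def w_def C_def using PZ[of l]
      by (intro class_drift par e k \<theta> d PB) (auto simp: z d_def)
    then obtain b where b: "\<And>l. b l \<le> - ((real (P l) - lam l / mu l * real r) * d)"
      "\<And>l. P l = Z l \<Longrightarrow> b l \<le> 2 * k - e * \<bar>z l\<bar>" "\<And>l. T l \<le> \<theta> * (b l + (1 / k + \<theta> / mu l) * C l)"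
      by (metis of_nat_eq_iff)
    have "(\<Sum>l\<in>UNIV. T l) \<le> (\<Sum>l\<in>UNIV. \<theta> * (b l + (1 / k + \<theta> / mu l) * C l))"
      using b by (intro sum_mono)
    also have "\<dots> = \<theta> * ((\<Sum>l\<in>UNIV. b l) + (\<Sum>l\<in>UNIV. (1 / k + \<theta> / mu l) * C l))"
      by (simp add: sum_distrib_left[symmetric] sum.distrib)
    also have "\<dots> \<le> \<theta> * ((\<Sum>l\<in>UNIV. b l) + a / 2)"
      using \<theta> second by (intro mult_left_mono) auto
    finally have Tb: "(\<Sum>l\<in>UNIV. T l) + c \<le> \<theta> * ((\<Sum>l\<in>UNIV. b l) + a)"
      by (simp add: c_def algebra_simps)
    \<comment> \<open>Either the bracket is nonpositive, or some server is idle and the state lies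
      in a bounded region.\<close>
    have goal: "exp (\<Sum>i\<in>UNIV. \<theta> * w i (z i)) * ((\<Sum>l\<in>UNIV. T l) + c) \<le> c * K"
    proof (cases "(\<Sum>l\<in>UNIV. b l) + a \<le> 0")
      case True
      then have "\<theta> * ((\<Sum>l\<in>UNIV. b l) + a) \<le> 0" using \<theta> by (simp add: mult_nonneg_nonpos less_imp_le)
      then have "exp (\<Sum>i\<in>UNIV. \<theta> * w i (z i)) * ((\<Sum>l\<in>UNIV. T l) + c) \<le> 0"
        using Tb by (intro mult_nonneg_nonpos) auto
      also have "0 \<le> c * K" using c K by simp
      finally show ?thesis .
    next
      case False
      \<comment> \<open>With all servers busy, the scaled service counts sum to at least
        \<open>a\<close> because the loads sum to 1; this would force
        \<open>\<Sum>l. b l \<le> - a\<close>.\<close>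
      have "(\<Sum>i\<in>UNIV. Z i) < num_servers a r"
      proof (rule ccontr)
        assume "\<not> ?thesis"
        then have "(\<Sum>i\<in>UNIV. P i) = num_servers a r" using sum by simp
        then have PN: "(\<Sum>i\<in>UNIV. real (P i)) = real (num_servers a r)" by (simp flip: of_nat_sum)
        have "(\<Sum>l\<in>UNIV. b l) \<le> (\<Sum>l\<in>UNIV. - ((real (P l) - lam l / mu l * real r) * d))"
          using b by (intro sum_mono)
        also have "\<dots> = - ((real (num_servers a r) - real r) * d)"
          by (simp only: sum_negf sum_distrib_right[symmetric] sum_subtractf PN crit mult_1_left)
        also have "\<dots> \<le> - (a * sqrt (real r) * d)"
          using N d by (simp add: mult_right_mono)
        also have "\<dots> = - a" using r by (simp add: d_def)
        finally show False using False by simp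
      qed
      then have "(\<Sum>i\<in>UNIV. P i) = (\<Sum>i\<in>UNIV. Z i)" using sum by simp
      \<comment> \<open>Equal totals together with \<open>P i \<le> Z i\<close> leave no queue in
        any class.\<close>
      then have "P l = Z l" for l
        using PZ sum_strict_mono_ex1[of UNIV P Z] by (metis UNIV_I finite le_neq_implies_less less_irrefl)
      then have "(\<Sum>l\<in>UNIV. b l) \<le> (\<Sum>l\<in>UNIV. 2 * k - e * \<bar>z l\<bar>)"
        by (intro sum_mono b(2))
      also have "\<dots> = 2 * real CARD('i) * k - e * (\<Sum>l\<in>UNIV. \<bar>z l\<bar>)"
        by (simp add: sum_subtractf sum_distrib_left)
      finally have bR: "(\<Sum>l\<in>UNIV. b l) + a \<le> R - e * (\<Sum>l\<in>UNIV. \<bar>z l\<bar>)" by (simp add: R_def)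
      have z0: "(\<Sum>l\<in>UNIV. \<bar>z l\<bar>) \<ge> 0" by (intro sum_nonneg) auto
      have zR: "(\<Sum>l\<in>UNIV. \<bar>z l\<bar>) \<le> R / e" using bR False e(1) by (simp add: field_simps)
      have "w i (z i) \<le> (3 * \<bar>z i\<bar> + 2 * k) / m" for i
        unfolding w_def using tilted_pos_bounds[of k e "z i"] k e m
        by (intro frac_le) auto
      then have "(\<Sum>i\<in>UNIV. w i (z i)) \<le> (\<Sum>i\<in>UNIV. (3 * \<bar>z i\<bar> + 2 * k) / m)"
        by (intro sum_mono)
      also have "\<dots> = (3 * (\<Sum>l\<in>UNIV. \<bar>z l\<bar>) + 2 * real CARD('i) * k) / m"
        by (simp add: sum_divide_distrib[symmetric] sum.distrib sum_distrib_left)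
      also have "\<dots> \<le> W"
        unfolding W_def using zR m by (intro divide_right_mono) auto
      finally have "\<theta> * (\<Sum>i\<in>UNIV. w i (z i)) \<le> \<theta> * W" using \<theta> by (intro mult_left_mono) auto
      then have ex: "exp (\<Sum>i\<in>UNIV. \<theta> * w i (z i)) \<le> exp (\<theta> * W)"
        by (simp add: sum_distrib_left)
      have "(\<Sum>l\<in>UNIV. b l) + a \<le> R" using bR z0 e(1) by (smt (verit) mult_nonneg_nonneg)
      then have "\<theta> * ((\<Sum>l\<in>UNIV. b l) + a) \<le> \<theta> * R" using \<theta> by (intro mult_left_mono) auto
      then have "(\<Sum>l\<in>UNIV. T l) + c \<le> \<theta> * R" using Tb by simp
      then have "exp (\<Sum>i\<in>UNIV. \<theta> * w i (z i)) * ((\<Sum>l\<in>UNIV. T l) + c) \<le> exp (\<Sum>i\<in>UNIV. \<theta> * w i (z i)) * (\<theta> * R)"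
        by (intro mult_left_mono) auto
      also have "\<dots> \<le> exp (\<theta> * W) * (\<theta> * R)"
        using ex \<theta> R by (intro mult_right_mono) auto
      also have "\<dots> = c * K" using c by (simp add: K_def)
      finally show ?thesis .
    qed
    show "exp (\<Sum>i\<in>UNIV. \<theta> * w i (z i)) *
      (\<Sum>l\<in>UNIV. lam l * real r * (exp (\<theta> * w l (z l + 1 / sqrt (real r)) - \<theta> * w l (z l)) - 1) +
        (mu l * real (P l) + nu l * (real (Z l) - real (P l))) * (exp (\<theta> * w l (z l - 1 / sqrt (real r)) - \<theta> * w l (z l)) - 1))
      \<le> c * K - c * exp (\<Sum>i\<in>UNIV. \<theta> * w i (z i))"
      using goal unfolding T_def d_def[symmetric] right_diff_distrib[symmetric, of \<theta>]
      by (simp add: distrib_left mult.commute[of c])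
  qed
  \<comment> \<open>From \<open>tilted_pos e k y \<ge> e * \<bar>y\<bar>\<close> and
    \<open>mu i \<le> M\<close>, the potential dominates \<open>\<eta>\<close> times the sum of
    absolute values.\<close>
  define \<eta> where "\<eta> = \<theta> * e / M"
  have le: "\<eta> * (\<Sum>i\<in>UNIV. \<bar>z i\<bar>) \<le> (\<Sum>i\<in>UNIV. \<theta> * w i (z i))" for z :: "'i \<Rightarrow> real"
  proof -
    have "\<eta> * \<bar>z i\<bar> \<le> \<theta> * w i (z i)" for i
    proof -
      have "e * \<bar>z i\<bar> / M \<le> e * \<bar>z i\<bar> / mu i"
        using e(1) muM[of i] par(2)[of i] by (intro divide_left_mono) (auto simp: M)
      also have "\<dots> \<le> w i (z i)"
        unfolding w_def using tilted_pos_bounds[of k e "z i"] k e par(2)[of i]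
        by (intro divide_right_mono) auto
      finally have "\<theta> * (e * \<bar>z i\<bar> / M) \<le> \<theta> * w i (z i)" using \<theta> by (intro mult_left_mono) auto
      then show ?thesis by (simp add: \<eta>_def)
    qed
    then show ?thesis unfolding sum_distrib_left by (intro sum_mono)
  qed
  have "\<eta> > 0" using \<theta> e M by (simp add: \<eta>_def)
  moreover have "(\<integral>\<^sup>+x. ennreal (exp (\<eta> * (\<Sum>i\<in>UNIV. \<bar>Zhat lam mu r f x i\<bar>))) \<partial>measure_pmf p) \<le> ennreal K"
    if "r \<ge> 1" "service_system a lam mu nu r S q f" "stationary_distribution S q p"
    for r S q p and f :: "'s \<Rightarrow> ('i \<Rightarrow> nat) \<times> ('i \<Rightarrow> nat)"
    by (rule order_trans[OF nn_integral_mono bound[OF that]]) (auto intro!: ennreal_leI le)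
  ultimately show ?thesis using K by blast
qed

section \<open>Limits superior, tightness and assembly\<close>

lemma limsup_less_top:
  fixes u :: "nat \<Rightarrow> ennreal"
  assumes "\<And>r. r \<ge> 1 \<Longrightarrow> u r \<le> ennreal K"
  shows "limsup u < \<infinity>"
proof -
  have "limsup u \<le> ennreal K"
    using assms by (intro Limsup_bounded eventually_sequentiallyI[of 1])
  then show ?thesis using le_less_trans by fastforce
qed

text \<open>Markov's inequality, with the exponential weakened to its linear lower bound so that the
  cutoff needs no logarithm.\<close>

lemma tight_of_exp_moment:
  fixes X :: "nat \<Rightarrow> 's \<Rightarrow> real"
  assumes \<eta>: "\<eta> > 0" and K: "K \<ge> 0"
    and bd: "\<And>n. (\<integral>\<^sup>+x. ennreal (exp (\<eta> * \<bar>X n x\<bar>)) \<partial>measure_pmf (p n)) \<le> ennreal K"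
  shows "tight (\<lambda>n. distr (measure_pmf (p n)) borel (X n))"
  unfolding tight_def
proof (intro conjI allI impI)
  show "real_distribution (distr (measure_pmf (p n)) borel (X n))" for n
    by (rule prob_space.real_distribution_distr) (auto intro: measure_pmf.prob_space_axioms)
  fix \<epsilon> :: real assume \<epsilon>: "\<epsilon> > 0"
  \<comment> \<open>Then \<open>\<eta> * L = (K + 1) / \<epsilon>\<close>, and the tail mass is at
    most \<open>K * \<epsilon> / (K + 1)\<close>, strictly below \<open>\<epsilon>\<close> even when
    \<open>K = 0\<close>.\<close>
  define L where "L = (K + 1) / (\<epsilon> * \<eta>)"
  have L: "L > 0" using K \<epsilon> \<eta> by (simp add: L_def)
  show "\<exists>a b. a < b \<and> (\<forall>n. measure (distr (measure_pmf (p n)) borel (X n)) {a<..b} > 1 - \<epsilon>)"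
  proof (intro exI conjI allI)
    show "- L < L" using L by simp
    fix n
    let ?A = "{x. \<bar>X n x\<bar> \<ge> L}"
    have "ennreal (\<eta> * L) * emeasure (measure_pmf (p n)) ?A
        = (\<integral>\<^sup>+x. ennreal (\<eta> * L) * indicator ?A x \<partial>measure_pmf (p n))"
      by (simp add: nn_integral_cmult_indicator)
    also have "\<dots> \<le> (\<integral>\<^sup>+x. ennreal (exp (\<eta> * \<bar>X n x\<bar>)) \<partial>measure_pmf (p n))"
    proof (intro nn_integral_mono)
      fix x
      show "ennreal (\<eta> * L) * indicator ?A x \<le> ennreal (exp (\<eta> * \<bar>X n x\<bar>))"
      proof (cases "x \<in> ?A")
        case True
        then have "\<eta> * L \<le> \<eta> * \<bar>X n x\<bar>" using \<eta> by (intro mult_left_mono) auto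
        also have "\<dots> \<le> exp (\<eta> * \<bar>X n x\<bar>)" using exp_ge_add_one_self[of "\<eta> * \<bar>X n x\<bar>"] by linarith
        finally show ?thesis using True by (simp add: ennreal_leI)
      qed simp
    qed
    also note bd
    finally have "\<eta> * L * measure (measure_pmf (p n)) ?A \<le> K"
      using \<eta> L K by (simp add: measure_pmf.emeasure_eq_measure ennreal_mult[symmetric])
    moreover have "\<eta> * L = (K + 1) / \<epsilon>" using \<eta> by (simp add: L_def)
    ultimately have "(K + 1) * measure (measure_pmf (p n)) ?A / \<epsilon> \<le> K"
      by (metis times_divide_eq_left)
    then have "(K + 1) * measure (measure_pmf (p n)) ?A \<le> K * \<epsilon>"
      using \<epsilon> by (simp only: pos_divide_le_eq)
    also have "\<dots> < (K + 1) * \<epsilon>" using \<epsilon> by simp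
    finally have small: "measure (measure_pmf (p n)) ?A < \<epsilon>" using K by simp
    have "measure (measure_pmf (p n)) (- ?A) = 1 - measure (measure_pmf (p n)) ?A"
      using measure_pmf.prob_compl[of ?A "p n"] by (simp add: Compl_eq_Diff_UNIV)
    also have "\<dots> > 1 - \<epsilon>" using small by simp
    finally have "1 - \<epsilon> < measure (measure_pmf (p n)) (- ?A)" .
    also have "\<dots> \<le> measure (measure_pmf (p n)) (X n -` {- L<..L})"
      by (intro measure_pmf.finite_measure_mono) auto
    finally show "1 - \<epsilon> < measure (distr (measure_pmf (p n)) borel (X n)) {- L<..L}"
      by (simp add: measure_distr)
  qed
qed

text \<open>Tightness is indexed by \<open>Suc n\<close> because it concerns every member of the
  sequence and the model starts at \<open>r = 1\<close>; a limit superior ignores the index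
  0.\<close>

theorem theorem2:
  fixes a :: real
    and lam mu nu :: "'i::finite \<Rightarrow> real"
    and S :: "nat \<Rightarrow> 's set"
    and q :: "nat \<Rightarrow> 's \<Rightarrow> 's \<Rightarrow> real"
    and f :: "nat \<Rightarrow> 's \<Rightarrow> ('i \<Rightarrow> nat) \<times> ('i \<Rightarrow> nat)"
    and p :: "nat \<Rightarrow> 's pmf"
  assumes "a > 0"
    and "\<And>i. lam i > 0" and "\<And>i. mu i > 0" and "\<And>i. nu i \<ge> 0"
    and "(\<Sum>i\<in>UNIV. lam i / mu i) = 1"
    and "\<And>r. r \<ge> 1 \<Longrightarrow> service_system a lam mu nu r (S r) (q r) (f r)"
    and "\<And>r. r \<ge> 1 \<Longrightarrow> stationary_distribution (S r) (q r) (p r)"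
  shows "((\<forall>i. nu i \<le> mu i) \<longrightarrow>
           (\<forall>\<theta>>0. limsup (\<lambda>r. \<integral>\<^sup>+x. ennreal (exp (\<theta> *
              (\<Sum>i\<in>UNIV. neg_part (Zhat lam mu r (f r) x i)))) \<partial>measure_pmf (p r)) < \<infinity>))
       \<and> (\<exists>\<theta>\<^sub>0>0. \<forall>\<theta>\<in>{0..\<theta>\<^sub>0}. limsup (\<lambda>r. \<integral>\<^sup>+x. ennreal (exp (\<theta> *
              (\<Sum>i\<in>UNIV. pos_part (Zhat lam mu r (f r) x i)))) \<partial>measure_pmf (p r)) < \<infinity>)
       \<and> (\<exists>\<theta>\<^sub>0>0. \<forall>\<theta>\<in>{0..\<theta>\<^sub>0}. limsup (\<lambda>r. \<integral>\<^sup>+x. ennreal (exp (\<theta> *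
              (\<Sum>i\<in>UNIV. neg_part (Zhat lam mu r (f r) x i)))) \<partial>measure_pmf (p r)) < \<infinity>)
       \<and> tight (\<lambda>n. distr (measure_pmf (p (Suc n))) borel
              (\<lambda>x. \<Sum>i\<in>UNIV. Zhat lam mu (Suc n) (f (Suc n)) x i))"
proof -
  obtain \<eta> K where \<eta>: "\<eta> > 0" and K: "K \<ge> 0"
    and bd: "\<And>r. r \<ge> 1 \<Longrightarrow>
      (\<integral>\<^sup>+x. ennreal (exp (\<eta> * (\<Sum>i\<in>UNIV. \<bar>Zhat lam mu r (f r) x i\<bar>))) \<partial>measure_pmf (p r)) \<le> ennreal K"
    using abs_exp_moment_bound[where 's='s and lam=lam and mu=mu and nu=nu, OF assms(1-5)] assms(6,7) by meson
  \<comment> \<open>Both \<open>pos_part\<close> and \<open>neg_part\<close> are dominated by the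
    absolute value, so \<open>\<eta>\<close> serves as the threshold for (ii) and (iii).\<close>
  have part: "limsup (\<lambda>r. \<integral>\<^sup>+x. ennreal (exp (\<theta> * (\<Sum>i\<in>UNIV. h (Zhat lam mu r (f r) x i)))) \<partial>measure_pmf (p r)) < \<infinity>"
    if h: "\<And>y. h y \<le> \<bar>y\<bar>" and \<theta>: "\<theta> \<in> {0..\<eta>}" for h :: "real \<Rightarrow> real" and \<theta>
  proof (rule limsup_less_top)
    fix r :: nat assume r: "r \<ge> 1"
    have "\<theta> * (\<Sum>i\<in>UNIV. h (z i)) \<le> \<eta> * (\<Sum>i\<in>UNIV. \<bar>z i\<bar>)" for z :: "'i \<Rightarrow> real"
    proof -
      have "\<theta> * (\<Sum>i\<in>UNIV. h (z i)) \<le> \<theta> * (\<Sum>i\<in>UNIV. \<bar>z i\<bar>)"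
        using \<theta> h by (intro mult_left_mono sum_mono) auto
      also have "\<dots> \<le> \<eta> * (\<Sum>i\<in>UNIV. \<bar>z i\<bar>)"
        using \<theta> by (intro mult_right_mono sum_nonneg) auto
      finally show ?thesis .
    qed
    then show "(\<integral>\<^sup>+x. ennreal (exp (\<theta> * (\<Sum>i\<in>UNIV. h (Zhat lam mu r (f r) x i)))) \<partial>measure_pmf (p r)) \<le> ennreal K"
      by (intro order_trans[OF nn_integral_mono bd[OF r]] ennreal_leI) simp
  qed
  show ?thesis
  proof (intro conjI impI allI)
    fix \<theta> :: real assume nu: "\<forall>i. nu i \<le> mu i" and \<theta>: "\<theta> > 0"
    obtain K' where "\<And>r. r \<ge> 1 \<Longrightarrow>
      (\<integral>\<^sup>+x. ennreal (exp (\<theta> * (\<Sum>i\<in>UNIV. neg_part (Zhat lam mu r (f r) x i)))) \<partial>measure_pmf (p r)) \<le> ennreal K'"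
      using neg_part_exp_moment_bound[where 's='s and a=a and lam=lam and mu=mu and nu=nu, OF assms(2-4) nu[rule_format] \<theta>] assms(6,7) by meson
    then show "limsup (\<lambda>r. \<integral>\<^sup>+x. ennreal (exp (\<theta> *
              (\<Sum>i\<in>UNIV. neg_part (Zhat lam mu r (f r) x i)))) \<partial>measure_pmf (p r)) < \<infinity>"
      by (rule limsup_less_top)
  next
    show "\<exists>\<theta>\<^sub>0>0. \<forall>\<theta>\<in>{0..\<theta>\<^sub>0}. limsup (\<lambda>r. \<integral>\<^sup>+x. ennreal (exp (\<theta> *
              (\<Sum>i\<in>UNIV. pos_part (Zhat lam mu r (f r) x i)))) \<partial>measure_pmf (p r)) < \<infinity>"
      using \<eta> part[of pos_part] by (intro exI[of _ \<eta>]) (auto simp: pos_part_def)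
    show "\<exists>\<theta>\<^sub>0>0. \<forall>\<theta>\<in>{0..\<theta>\<^sub>0}. limsup (\<lambda>r. \<integral>\<^sup>+x. ennreal (exp (\<theta> *
              (\<Sum>i\<in>UNIV. neg_part (Zhat lam mu r (f r) x i)))) \<partial>measure_pmf (p r)) < \<infinity>"
      using \<eta> part[of neg_part] by (intro exI[of _ \<eta>]) (auto simp: neg_part_def)
    show "tight (\<lambda>n. distr (measure_pmf (p (Suc n))) borel
              (\<lambda>x. \<Sum>i\<in>UNIV. Zhat lam mu (Suc n) (f (Suc n)) x i))"
    proof (rule tight_of_exp_moment[OF \<eta> K])
      fix n
      have "\<eta> * \<bar>\<Sum>i\<in>UNIV. z i\<bar> \<le> \<eta> * (\<Sum>i\<in>UNIV. \<bar>z i\<bar>)" for z :: "'i \<Rightarrow> real"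
        using \<eta> by (intro mult_left_mono sum_abs) auto
      then show "(\<integral>\<^sup>+x. ennreal (exp (\<eta> * \<bar>\<Sum>i\<in>UNIV. Zhat lam mu (Suc n) (f (Suc n)) x i\<bar>)) \<partial>measure_pmf (p (Suc n))) \<le> ennreal K"
        by (intro order_trans[OF nn_integral_mono bd[of "Suc n"]] ennreal_leI) simp_all
    qed
  qed
qed

end
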